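(* Let $K\subset\mathbb{R}^n$ be a proper convex cone and $d\ge 2$. Then $\mathring{\mathrm{SL}}^d(K)$ is the interior of $\mathrm{SL}^d(K)$ in $\mathbb{R}[x]_n^d$, and $$\mathrm{SL}^d(K)=\overline{\mathring{\mathrm{SL}}^d(K)}.$$
   Context: $\mathbb{R}[x]_n^d$ is the finite-dimensional vector space (with its Euclidean topology) of real forms of degree $d$ in $n$ variables; the bar denotes closure. A convex cone $K\subset\mathbb{R}^n$ is proper if it is closed, pointed ($K\cap(-K)=\{0\}$) and has nonempty interior $\mathrm{int}\,K$. $D_af=\sum_i a_i\,\partial f/\partial x_i$. The matrix of a quadratic form $q$ is the symmetric matrix $Q$ with $q(x)=x^tQx$. A form $f\in\mathbb{R}[x]_n^d$ ($d\ge2$) is $K$-Lorentzian if either $f=0$ or, for all $a_1,\dots,a_{d-2}\in\mathrm{int}\,K$, the matrix $Q$ of $q=D_{a_1}\cdots D_{a_{d-2}}f$ has exactly one positive eigenvalue and satisfies $y^tQx>0$ for all $x,y\in\mathrm{int}\,K$. $\mathrm{SL}^d(K)$ is the set of $K$-Lorentzian forms in $\mathbb{R}[x]_n^d$. $\mathring{\mathrm{SL}}^d(K)$ is the set of $f\in\mathrm{SL}^d(K)$ such that for all nonzero $a_1,\dots,a_{d-2}\in K$, the matrix $Q$ of $q=D_{a_1}\cdots D_{a_{d-2}}f$ is nonsingular and $x^tQy>0$ for all nonzero $x,y\in K$. *)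

theory Defs
  imports "HOL-Analysis.Analysis"
begin

text \<open>
  A polynomial in the variables indexed by \<open>'n\<close> is represented by its coefficient function:
  \<open>f \<alpha>\<close> is the coefficient of the monomial \<open>\<Prod>i. x\<^sub>i ^ \<alpha> i\<close>. A coefficient function supported in
  degree \<open>d\<close> has finite support, so \<open>forms d\<close> is the finite-dimensional coordinate space of
  forms of degree \<open>d\<close>. The library topology on the function type is the product topology;
  on \<open>forms d\<close> it induces the Euclidean topology of the finitely many coefficients.
\<close>

type_synonym 'n polyn = "('n \<Rightarrow> nat) \<Rightarrow> real"

definition forms :: "nat \<Rightarrow> ('n::finite) polyn set" where
  "forms d = {f. \<forall>\<alpha>. f \<alpha> \<noteq> 0 \<longrightarrow> (\<Sum>i\<in>UNIV. \<alpha> i) = d}"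

abbreviation forms_topology :: "nat \<Rightarrow> ('n::finite) polyn topology" where
  "forms_topology d \<equiv> subtopology euclidean (forms d)"

definition poly_eval :: "('n::finite) polyn \<Rightarrow> real ^ 'n \<Rightarrow> real" where
  "poly_eval f x = (\<Sum>\<alpha> | f \<alpha> \<noteq> 0. f \<alpha> * (\<Prod>i\<in>UNIV. (x $ i) ^ \<alpha> i))"

text \<open>
  The formal partial derivative: the monomial with exponent \<open>\<alpha>\<close> in \<open>\<partial>f/\<partial>x\<^sub>i\<close> arises from
  the one with exponent \<open>\<alpha> + e\<^sub>i\<close> in \<open>f\<close>.
\<close>

definition partial_deriv :: "'n \<Rightarrow> ('n::finite) polyn \<Rightarrow> 'n polyn" where
  "partial_deriv i f = (\<lambda>\<alpha>. real (\<alpha> i + 1) * f (\<alpha>(i := \<alpha> i + 1)))"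

definition dir_deriv :: "real ^ 'n \<Rightarrow> ('n::finite) polyn \<Rightarrow> 'n polyn" where
  "dir_deriv a f = (\<lambda>\<alpha>. \<Sum>i\<in>UNIV. a $ i * partial_deriv i f \<alpha>)"

abbreviation dir_derivs :: "(real ^ 'n) list \<Rightarrow> ('n::finite) polyn \<Rightarrow> 'n polyn" where
  "dir_derivs as f \<equiv> foldr dir_deriv as f"


definition quad_matrix :: "('n::finite) polyn \<Rightarrow> real ^ 'n ^ 'n" where
  "quad_matrix q = (THE Q. transpose Q = Q \<and> (\<forall>x. poly_eval q x = x \<bullet> (Q *v x)))"

text \<open>
  Eigenvalues are counted with multiplicity. The matrices below are symmetric, so the dimension
  of the eigenspace is the multiplicity.
\<close>

definition num_pos_eigenvalues :: "real ^ 'n ^ 'n \<Rightarrow> nat" where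
  "num_pos_eigenvalues Q =
     (\<Sum>c | 0 < c \<and> (\<exists>v. v \<noteq> 0 \<and> Q *v v = c *\<^sub>R v). dim {v. Q *v v = c *\<^sub>R v})"


definition proper_convex_cone :: "(real ^ 'n) set \<Rightarrow> bool" where
  "proper_convex_cone K \<longleftrightarrow>
     convex_cone K \<and> closed K \<and> K \<inter> uminus ` K = {0} \<and> interior K \<noteq> {}"

definition lorentzian_forms :: "nat \<Rightarrow> (real ^ 'n) set \<Rightarrow> ('n::finite) polyn set" where
  "lorentzian_forms d K = {f \<in> forms d. f = (\<lambda>_. 0) \<or>
     (\<forall>as. length as = d - 2 \<and> set as \<subseteq> interior K \<longrightarrow>
        (let Q = quad_matrix (dir_derivs as f) in
           num_pos_eigenvalues Q = 1 \<and>
           (\<forall>x\<in>interior K. \<forall>y\<in>interior K. y \<bullet> (Q *v x) > 0)))}"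

definition strictly_lorentzian_forms :: "nat \<Rightarrow> (real ^ 'n) set \<Rightarrow> ('n::finite) polyn set" where
  "strictly_lorentzian_forms d K = {f \<in> lorentzian_forms d K.
     \<forall>as. length as = d - 2 \<and> set as \<subseteq> K - {0} \<longrightarrow>
        (let Q = quad_matrix (dir_derivs as f) in
           invertible Q \<and> (\<forall>x\<in>K - {0}. \<forall>y\<in>K - {0}. x \<bullet> (Q *v y) > 0))}"


lemma dir_deriv_forms:
  assumes "f \<in> forms (Suc d)" shows "dir_deriv a f \<in> forms d"
proof -
  have "(\<Sum>i\<in>UNIV. \<alpha> i) = d" if "dir_deriv a f \<alpha> \<noteq> 0" for \<alpha>
  proof -
    obtain i where "f (\<alpha>(i := \<alpha> i + 1)) \<noteq> 0"
      using \<open>dir_deriv a f \<alpha> \<noteq> 0\<close> unfolding dir_deriv_def partial_deriv_def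
      by (metis (no_types, lifting) mult_eq_0_iff sum.neutral)
    then have "(\<Sum>j\<in>UNIV. (\<alpha>(i := \<alpha> i + 1)) j) = Suc d"
      using assms unfolding forms_def by blast
    moreover have "(\<Sum>j\<in>UNIV. (\<alpha>(i := \<alpha> i + 1)) j) = (\<alpha> i + 1) + (\<Sum>j\<in>UNIV - {i}. \<alpha> j)"
      by (subst sum.remove[of _ i]) (auto intro: sum.cong)
    moreover have "(\<Sum>j\<in>UNIV. \<alpha> j) = \<alpha> i + (\<Sum>j\<in>UNIV - {i}. \<alpha> j)"
      by (subst sum.remove[of _ i]) auto
    ultimately show ?thesis by simp
  qed
  then show ?thesis by (simp add: forms_def)
qed

lemma dir_derivs_forms:
  "f \<in> forms (d + length as) \<Longrightarrow> dir_derivs as f \<in> forms d"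
  by (induction as arbitrary: d) (auto intro!: dir_deriv_forms)

lemma finite_multi_indices: "finite {\<alpha>. (\<Sum>i\<in>(UNIV::'n::finite set). \<alpha> i) = (d::nat)}"
proof (rule finite_subset)
  show "{\<alpha>. (\<Sum>i\<in>(UNIV::'n set). \<alpha> i) = d} \<subseteq> PiE UNIV (\<lambda>_. {..d})"
    by (auto intro: member_le_sum)
qed (auto intro: finite_PiE)

lemma finite_eigenvalues:
  fixes Q :: "real ^ 'n ^ 'n"
  assumes "transpose Q = Q"
  shows "finite {c. \<exists>v. v \<noteq> 0 \<and> Q *v v = c *\<^sub>R v}" (is "finite ?E")
proof -
  have "\<forall>c\<in>?E. \<exists>v. v \<noteq> 0 \<and> Q *v v = c *\<^sub>R v" by blast
  then obtain v where v: "\<And>c. c \<in> ?E \<Longrightarrow> v c \<noteq> 0 \<and> Q *v v c = c *\<^sub>R v c"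
    using bchoice by (metis (no_types, lifting))
  have orth: "v c \<bullet> v c' = 0" if "c \<in> ?E" "c' \<in> ?E" "c \<noteq> c'" for c c'
  proof -
    have "(Q *v v c) \<bullet> v c' = v c \<bullet> (Q *v v c')"
      using dot_lmul_matrix[of "v c" Q "v c'"] vector_transpose_matrix[of "v c" Q] assms by simp
    then have "(c - c') * (v c \<bullet> v c') = 0"
      using v[OF that(1)] v[OF that(2)] by (simp add: algebra_simps)
    then show ?thesis using that by simp
  qed
  have "pairwise orthogonal (v ` ?E)" "0 \<notin> v ` ?E"
    using v orth unfolding pairwise_def orthogonal_def by force+
  then have "finite (v ` ?E)"
    using pairwise_orthogonal_independent independent_imp_finite by blast
  moreover have "inj_on v ?E"
  proof (rule inj_onI, rule ccontr)
    fix c c' assume h: "c \<in> ?E" "c' \<in> ?E" "v c = v c'" "c \<noteq> c'"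
    then have "v c \<bullet> v c = 0" using orth[OF h(1,2,4)] by simp
    then show False using v[OF h(1)] by simp
  qed
  ultimately show ?thesis using finite_imageD by blast
qed

lemma quad_matrix_ex1:
  fixes q :: "('n::finite) polyn"
  assumes "q \<in> forms 2"
  shows "\<exists>!Q. transpose Q = Q \<and> (\<forall>x. poly_eval q x = x \<bullet> (Q *v x))"
proof (rule ex_ex1I)
  have monomial_matrix: "\<exists>Q::real^'n^'n. \<forall>x. (\<Prod>i\<in>UNIV. (x $ i) ^ \<alpha> i) = x \<bullet> (Q *v x)"
    if "(\<Sum>i\<in>(UNIV::'n set). \<alpha> i) = 2" for \<alpha>
  proof -
    obtain i where i: "\<alpha> i \<noteq> 0"
    proof (rule ccontr)
      assume "\<not> thesis"
      then have "\<And>i. \<alpha> i = 0" using that by blast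
      then show False using \<open>(\<Sum>i\<in>UNIV. \<alpha> i) = 2\<close> by simp
    qed
    define \<beta> where "\<beta> = \<alpha>(i := \<alpha> i - 1)"
    have "(\<Sum>i\<in>UNIV. \<alpha> i) = \<alpha> i + (\<Sum>j\<in>UNIV-{i}. \<alpha> j)"
      "(\<Sum>i\<in>UNIV. \<beta> i) = (\<alpha> i - 1) + (\<Sum>j\<in>UNIV-{i}. \<alpha> j)"
      by (simp_all add: \<beta>_def sum.remove[of UNIV i])
    then have b1: "(\<Sum>i\<in>UNIV. \<beta> i) = 1" using that i by linarith
    then obtain j where j: "\<beta> j = 1" "\<And>k. k \<noteq> j \<Longrightarrow> \<beta> k = 0"
      using sum_eq_1_iff[of UNIV \<beta>] by (metis UNIV_I finite_code)
    have p: "(\<Prod>k\<in>UNIV. (x $ k) ^ \<alpha> k) = x $ i * x $ j" for x :: "real^'n"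
    proof -
      have "(\<Prod>k\<in>UNIV. (x $ k) ^ \<alpha> k) = (x $ i) ^ \<alpha> i * (\<Prod>k\<in>UNIV-{i}. (x $ k) ^ \<alpha> k)"
        by (subst prod.remove[of _ i]) auto
      also have "(x $ i) ^ \<alpha> i = x $ i * (x $ i) ^ \<beta> i"
        using i by (simp add: \<beta>_def power_eq_if)
      also have "(\<Prod>k\<in>UNIV-{i}. (x $ k) ^ \<alpha> k) = (\<Prod>k\<in>UNIV-{i}. (x $ k) ^ \<beta> k)"
        by (rule prod.cong) (auto simp: \<beta>_def)
      also have "x $ i * (x $ i) ^ \<beta> i * (\<Prod>k\<in>UNIV-{i}. (x $ k) ^ \<beta> k)
          = x $ i * (\<Prod>k\<in>UNIV. (x $ k) ^ \<beta> k)"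
        by (subst prod.remove[of UNIV i]) auto
      also have "(\<Prod>k\<in>UNIV. (x $ k) ^ \<beta> k) = x $ j"
        by (subst prod.remove[of _ j]) (auto simp: j intro: prod.neutral)
      finally show ?thesis .
    qed
    define Q :: "real^'n^'n" where "Q = (\<chi> k l. if k = i \<and> l = j then 1 else 0)"
    have "x \<bullet> (Q *v x) = x $ i * x $ j" for x
    proof -
      have *: "(Q *v x) $ k = (if k = i then x $ j else 0)" for k
        by (cases "k = i") (simp_all add: Q_def matrix_vector_mult_def if_distribR
            if_distrib[where f = "\<lambda>u. u * (x $ l)" for l] cong: if_cong)
      show ?thesis
        by (simp add: inner_vec_def * if_distrib[where f = "\<lambda>u. (x $ l) * u" for l] cong: if_cong)
    qed
    then show ?thesis using p by metis
  qed
  have "\<forall>\<alpha>\<in>{\<alpha>. q \<alpha> \<noteq> 0}. \<exists>Q::real^'n^'n. \<forall>x. (\<Prod>i\<in>UNIV. (x $ i) ^ \<alpha> i) = x \<bullet> (Q *v x)"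
    using assms monomial_matrix by (auto simp: forms_def)
  then obtain M :: "('n \<Rightarrow> nat) \<Rightarrow> real^'n^'n"
    where M: "\<And>\<alpha> x. q \<alpha> \<noteq> 0 \<Longrightarrow> (\<Prod>i\<in>UNIV. (x $ i) ^ \<alpha> i) = x \<bullet> (M \<alpha> *v x)"
    using bchoice[of "{\<alpha>. q \<alpha> \<noteq> 0}"
        "\<lambda>\<alpha> Q. \<forall>x. (\<Prod>i\<in>UNIV. (x $ i) ^ \<alpha> i) = x \<bullet> (Q *v x)"] by blast
  define P where "P = (\<Sum>\<alpha> | q \<alpha> \<noteq> 0. q \<alpha> *\<^sub>R M \<alpha>)"
  have sumv: "(\<Sum>\<alpha>\<in>A. q \<alpha> *\<^sub>R M \<alpha>) *v x = (\<Sum>\<alpha>\<in>A. q \<alpha> *\<^sub>R (M \<alpha> *v x))" for A x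
    by (induction A rule: infinite_finite_induct)
      (simp_all add: matrix_vector_mult_add_rdistrib scaleR_matrix_vector_assoc)
  have P: "poly_eval q x = x \<bullet> (P *v x)" for x
    using M by (simp add: poly_eval_def P_def sumv inner_sum_right)
  have t: "x \<bullet> (transpose P *v x) = x \<bullet> (P *v x)" for x
    using dot_lmul_matrix[of x P x] transpose_matrix_vector[of P x] by (simp add: inner_commute)
  define S where "S = (1/2) *\<^sub>R (P + transpose P)"
  have "transpose S = S"
    by (simp add: S_def transpose_def vec_eq_iff)
  moreover have "poly_eval q x = x \<bullet> (S *v x)" for x
    unfolding S_def scaleR_matrix_vector_assoc[symmetric] matrix_vector_mult_add_rdistrib
      inner_scaleR_right inner_add_right t P by simp
  ultimately show "\<exists>Q. transpose Q = Q \<and> (\<forall>x. poly_eval q x = x \<bullet> (Q *v x))"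
    by blast
next
  fix A B :: "real^'n^'n"
  assume A: "transpose A = A \<and> (\<forall>x. poly_eval q x = x \<bullet> (A *v x))"
    and B: "transpose B = B \<and> (\<forall>x. poly_eval q x = x \<bullet> (B *v x))"
  have pol: "2 * (x \<bullet> (C *v y)) = poly_eval q (x + y) - poly_eval q x - poly_eval q y"
    if C: "transpose C = C \<and> (\<forall>x. poly_eval q x = x \<bullet> (C *v x))" for C :: "real^'n^'n" and x y
  proof -
    have "y \<bullet> (C *v x) = x \<bullet> (C *v y)"
      using dot_lmul_matrix[of y C x] vector_transpose_matrix[of y C] C by (simp add: inner_commute)
    then show ?thesis
      using C by (simp add: matrix_vector_right_distrib inner_add_left inner_add_right)
  qed
  have "x \<bullet> (A *v y) = x \<bullet> (B *v y)" for x y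
    using pol[OF A, of x y] pol[OF B, of x y] by simp
  then have "A *v y = B *v y" for y
    using vector_eq_ldot[of "A *v y" "B *v y"] by simp
  then show "A = B" by (simp add: matrix_eq)
qed

end

theory Submission
  imports Defs
begin

text \<open>
  A form \<open>f\<close> of degree \<open>d\<close> is studied through its polarisation
  \<open>T(a\<^sub>1, \<dots>, a\<^sub>d) = D\<^sub>a\<^sub>1 \<cdots> D\<^sub>a\<^sub>d f\<close> (the constant \<open>polar\<close>), a symmetric multilinear form. The
  quadratic forms that occur in the definitions are \<open>(x, y) \<mapsto> T(x, y, a\<^sub>1, \<dots>, a\<^sub>d\<^sub>-\<^sub>2) / 2\<close>.

  \<^bold>\<open>Signature.\<close> A symmetric bilinear form \<open>B\<close> with \<open>B(u, u) > 0\<close> has exactly one positive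
  eigenvalue if and only if the reversed Cauchy--Schwarz inequality
  \<open>B(u, u) B(x, x) \<le> B(u, x)\<^sup>2\<close> holds for all \<open>x\<close>, and for this it suffices that \<open>B \<le> 0\<close> on some
  hyperplane. Hence the Lorentzian condition says that \<open>T \<ge> 0\<close> on the interior of \<open>K\<close> and that
  reversed Cauchy--Schwarz holds there: the positivity of \<open>T\<close> for \<open>f \<noteq> 0\<close> comes for free,
  because a linear form that is nonnegative on an open set and vanishes at one of its points is
  zero. These are weak inequalities, so the set of Lorentzian forms is closed, and by continuity
  they persist for arguments on the boundary of \<open>K\<close>.

  \<^bold>\<open>Interior.\<close> Strictly Lorentzian forms form an open set by induction on the degree: \<open>f\<close> is strict
  if and only if \<open>D\<^sub>a f\<close> is strict for all \<open>a\<close> in the compact base \<open>K \<inter> sphere 0 1\<close>, and the tube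
  lemma applies; in degree two, strictness is the positivity of continuous functions on compact
  sets. Conversely, if \<open>f\<close> is an interior point, then \<open>f \<plusminus> t \<ell>\<^sup>d\<close> is Lorentzian for small \<open>t\<close> and every
  linear form \<open>\<ell>\<close>. The minus sign forces \<open>T > 0\<close> on nonzero vectors of \<open>K\<close>; the plus sign violates
  reversed Cauchy--Schwarz as soon as some matrix has a kernel vector \<open>z\<close> with \<open>\<ell>(z) \<noteq> 0\<close>.

  \<^bold>\<open>Density.\<close> A Lorentzian \<open>f \<noteq> 0\<close> is regularised by operators \<open>f \<mapsto> f + s \<ell> D\<^sub>w f\<close> with \<open>s > 0\<close>,
  \<open>w\<close> in the interior of \<open>K\<close>, and \<open>\<ell>\<close> positive on \<open>K - {0}\<close>. They preserve the Lorentzian property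
  since all the quadratic forms that get added are nonpositive on one common hyperplane. Each
  application lets one more argument of \<open>T\<close> move to the boundary of \<open>K\<close> without destroying
  positivity, and once \<open>T\<close> is positive on all of \<open>K - {0}\<close>, each application shrinks every kernel
  into its intersection with \<open>{z. \<ell>(z) = 0}\<close>. So \<open>d\<close> steps followed by one step for each
  member of a spanning family of such \<open>\<ell>\<close> give a strictly Lorentzian form, which tends to \<open>f\<close>
  as \<open>s \<rightarrow> 0\<close>. The zero form is a limit of
  multiples of \<open>\<ell>\<^sup>d\<close>.
\<close>

section \<open>Signature and the reversed Cauchy--Schwarz inequality\<close>

text \<open>
  If \<open>P v y \<noteq> 0\<close>, the affine function \<open>t \<mapsto> P (y + t v) (y + t v)\<close> takes negative values.
\<close>

lemma semidefinite_null_vector: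
  fixes P :: "'a::real_vector \<Rightarrow> 'a \<Rightarrow> real"
  assumes P: "bilinear P" and sym: "\<And>x y. P x y = P y x" and S: "subspace S"
    and psd: "\<And>x. x \<in> S \<Longrightarrow> 0 \<le> P x x"
    and v: "v \<in> S" "P v v = 0" and y: "y \<in> S"
  shows "P v y = 0"
proof (rule ccontr)
  assume n: "P v y \<noteq> 0"
  \<comment> \<open>chosen so that the value below is -1\<close>
  define t where "t = - (P y y + 1) / (2 * P v y)"
  have "0 \<le> P (y + t *\<^sub>R v) (y + t *\<^sub>R v)"
    using S v y by (intro psd) (simp add: subspace_add subspace_scale)
  also have "\<dots> = P y y + 2 * t * P v y"
    using v(2) sym[of y v]
    by (simp add: bilinear_ladd[OF P] bilinear_radd[OF P] bilinear_lmul[OF P] bilinear_rmul[OF P])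
  also have "\<dots> = - 1" using n by (simp add: t_def field_simps)
  finally show False by simp
qed

text \<open>
  Some vector \<open>x - t u\<close> lies on the hyperplane \<open>h = 0\<close>. There \<open>B x x \<le> 2 t B u x - t\<^sup>2 B u u\<close>, and
  the right-hand side is at most \<open>(B u x)\<^sup>2 / B u u\<close> whatever \<open>t\<close> is.
\<close>

lemma reversed_cauchy_schwarz_from_hyperplane:
  fixes B :: "'a::real_vector \<Rightarrow> 'a \<Rightarrow> real" and h :: "'a \<Rightarrow> real"
  assumes B: "bilinear B" and sym: "\<And>x y. B x y = B y x" and h: "linear h"
    and neg: "\<And>x. h x = 0 \<Longrightarrow> B x x \<le> 0" and u: "0 < B u u"
  shows "B u u * B x x \<le> (B u x)\<^sup>2"
proof -
  have hu: "h u \<noteq> (0::real)" using neg[of u] u by auto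
  define t where "t = h x / h u"
  have "h (x - t *\<^sub>R u) = 0"
    using hu by (simp add: linear_diff[OF h] linear_scale[OF h] t_def)
  then have "B (x - t *\<^sub>R u) (x - t *\<^sub>R u) \<le> 0" by (rule neg)
  then have "B x x \<le> 2 * t * B u x - t\<^sup>2 * B u u"
    using sym[of x u]
    by (simp add: bilinear_lsub[OF B] bilinear_rsub[OF B] bilinear_lmul[OF B] bilinear_rmul[OF B]
        power2_eq_square algebra_simps)
  then have "B u u * B x x \<le> B u u * (2 * t * B u x - t\<^sup>2 * B u u)"
    using u by simp
  also have "\<dots> = (B u x)\<^sup>2 - (B u x - t * B u u)\<^sup>2"
    by (simp add: power2_eq_square algebra_simps)
  finally show ?thesis using zero_le_power2[of "B u x - t * B u u"] by linarith
qed

text \<open>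
  On the \<open>B\<close>-orthogonal complement of \<open>u\<close> the form \<open>- B\<close> is positive semidefinite, so that its
  isotropic vectors there are null vectors.
\<close>

lemma isotropic_in_kernel:
  fixes B :: "'a::real_vector \<Rightarrow> 'a \<Rightarrow> real"
  assumes B: "bilinear B" and sym: "\<And>x y. B x y = B y x"
    and u: "0 < B u u" and rcs: "\<And>x. B u u * B x x \<le> (B u x)\<^sup>2"
    and z: "B u z = 0" "B z z = 0"
  shows "B z y = 0"
proof -
  note bl = bilinear_ladd[OF B] bilinear_radd[OF B] bilinear_lmul[OF B] bilinear_rmul[OF B]
    bilinear_lsub[OF B] bilinear_rsub[OF B]
  define S where "S = {x. B u x = 0}"
  have S: "subspace S"
    unfolding S_def subspace_def using bl bilinear_rzero[OF B] by simp
  have bN: "bilinear (\<lambda>x y. - B x y)"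
    using B unfolding bilinear_def linear_iff by simp
  have neg: "0 \<le> - B x x" if "x \<in> S" for x
    using rcs[of x] u that by (simp add: S_def mult_le_0_iff)
  define y' where "y' = y - (B u y / B u u) *\<^sub>R u"
  have "- B z y' = 0"
    by (rule semidefinite_null_vector[OF bN _ S])
       (use neg z sym u bl in \<open>auto simp: S_def y'_def\<close>)
  then show ?thesis using z(1) sym[of z u] bl by (simp add: y'_def)
qed

abbreviation matrix_form :: "real ^ 'n ^ 'n \<Rightarrow> real ^ 'n \<Rightarrow> real ^ 'n \<Rightarrow> real" where
  "matrix_form Q x y \<equiv> x \<bullet> (Q *v y)"

lemma bilinear_matrix_form: "bilinear (matrix_form Q)"
  by (auto simp: bilinear_def linear_iff inner_add_left matrix_vector_right_distrib inner_add_right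
      matrix_vector_mult_scaleR)

lemma matrix_form_commute:
  assumes "transpose Q = Q" shows "matrix_form Q x y = matrix_form Q y x"
  using dot_lmul_matrix[of x Q y] vector_transpose_matrix[of x Q] assms by (simp add: inner_commute)

text \<open>
  This is the part of the spectral theorem that the signature count uses. A maximiser \<open>v\<close> of the
  quadratic form on the unit sphere of \<open>S\<close> is a null vector of the semidefinite form
  \<open>c (x \<bullet> y) - x \<bullet> Q y\<close> on \<open>S\<close>, which makes it an eigenvector because \<open>S\<close> is invariant.
\<close>

lemma top_eigenvector:
  fixes Q :: "real ^ 'n ^ 'n"
  assumes Q: "transpose Q = Q" and S: "subspace S" and inv: "\<And>x. x \<in> S \<Longrightarrow> Q *v x \<in> S"
    and x0: "x0 \<in> S" "x0 \<noteq> 0"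
  obtains v c where "v \<in> S" "norm v = 1" "Q *v v = c *\<^sub>R v"
    "\<And>x. x \<in> S \<Longrightarrow> matrix_form Q x x \<le> c * (norm x)\<^sup>2"
proof -
  have nrm: "(1 / norm x) *\<^sub>R x \<in> S \<inter> sphere 0 1" if "x \<in> S" "x \<noteq> 0" for x
    using that S by (simp add: subspace_scale)
  have "compact (S \<inter> sphere 0 1)"
    using closed_subspace[OF S] by (simp add: closed_Int_compact)
  moreover have "S \<inter> sphere 0 1 \<noteq> {}" using nrm[OF x0] by blast
  moreover have "continuous_on (S \<inter> sphere 0 1) (\<lambda>x. matrix_form Q x x)"
    by (intro continuous_intros linear_continuous_on matrix_vector_mul_bounded_linear)
  ultimately obtain v where v: "v \<in> S \<inter> sphere 0 1"
      and m: "\<And>y. y \<in> S \<inter> sphere 0 1 \<Longrightarrow> matrix_form Q y y \<le> matrix_form Q v v"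
    using continuous_attains_sup[of "S \<inter> sphere 0 1" "\<lambda>x. matrix_form Q x x"] by blast
  define c where "c = matrix_form Q v v"
  have max: "matrix_form Q x x \<le> c * (norm x)\<^sup>2" if "x \<in> S" for x
  proof (cases "x = 0")
    case False
    from m[OF nrm[OF that False]] have "matrix_form Q x x / (norm x)\<^sup>2 \<le> c"
      by (simp add: c_def matrix_vector_mult_scaleR power2_eq_square)
    then show ?thesis using False by (simp add: divide_le_eq)
  qed simp
  define P where "P x y = c * (x \<bullet> y) - matrix_form Q x y" for x y
  have "bilinear P"
    by (auto simp: P_def bilinear_def linear_iff inner_add_left matrix_vector_right_distrib
        inner_add_right matrix_vector_mult_scaleR algebra_simps)
  then have "P v y = 0" if "y \<in> S" for y
    by (rule semidefinite_null_vector[OF _ _ S])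
       (use v max that matrix_form_commute[OF Q] in
        \<open>auto simp: P_def inner_commute power2_norm_eq_inner c_def norm_eq_1\<close>)
  then have "(c *\<^sub>R v - Q *v v) \<bullet> y = 0" if "y \<in> S" for y
    using that matrix_form_commute[OF Q, of v y]
    by (simp add: P_def inner_diff_left inner_commute[of "Q *v v" y])
  moreover have "c *\<^sub>R v - Q *v v \<in> S"
    using v inv S by (simp add: subspace_diff subspace_scale)
  ultimately have "c *\<^sub>R v - Q *v v = 0"
    using inner_eq_zero_iff by blast
  then show ?thesis using that[of v c] v max by simp
qed

lemma eigenspace_subspace: "subspace {v. Q *v v = c *\<^sub>R (v :: real ^ 'n)}"
  by (auto simp: subspace_def matrix_vector_right_distrib matrix_vector_mult_scaleR algebra_simps)

text \<open>
  Let \<open>v\<close> be a top eigenvector. If \<open>Q\<close> were positive somewhere on the hyperplane orthogonal to \<open>v\<close>,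
  the top eigenvector of this invariant hyperplane would contribute a second positive eigenvalue,
  or a second dimension to the same eigenspace. So \<open>Q \<le> 0\<close> on a hyperplane.
\<close>

lemma reversed_cauchy_schwarz_if_one_positive_eigenvalue:
  fixes Q :: "real ^ 'n ^ 'n"
  assumes Q: "transpose Q = Q" and one: "num_pos_eigenvalues Q = 1" and u: "0 < matrix_form Q u u"
  shows "matrix_form Q u u * matrix_form Q x x \<le> (matrix_form Q u x)\<^sup>2"
proof -
  define E where "E c = {v. Q *v v = c *\<^sub>R v}" for c
  define C where "C = {c. 0 < c \<and> (\<exists>v. v \<noteq> 0 \<and> Q *v v = c *\<^sub>R v)}"
  have fin: "finite C"
    using finite_eigenvalues[OF Q] by (rule finite_subset[rotated]) (auto simp: C_def)
  have total: "(\<Sum>c\<in>C. dim (E c)) = 1" using one by (simp add: num_pos_eigenvalues_def C_def E_def)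
  have u0: "u \<noteq> 0" using u by auto
  obtain v c where v: "norm v = 1" "Q *v v = c *\<^sub>R v"
      and c: "\<And>x. matrix_form Q x x \<le> c * (norm x)\<^sup>2"
    using top_eigenvector[OF Q subspace_UNIV UNIV_I UNIV_I u0] by (metis UNIV_I)
  have pos: "0 < c" using c[of u] u zero_le_power2[of "norm u"]
    by (smt (verit) mult_nonneg_nonneg mult_nonpos_nonneg)
  have v0: "v \<noteq> 0" using v by auto
  have "matrix_form Q x x \<le> 0" if "v \<bullet> x = 0" for x
  proof (rule ccontr)
    assume px: "\<not> matrix_form Q x x \<le> 0"
    define S where "S = {x. v \<bullet> x = 0}"
    have S: "subspace S" by (auto simp: S_def subspace_def inner_add_right)
    have inv: "Q *v y \<in> S" if "y \<in> S" for y
      using that matrix_form_commute[OF Q, of v y] v by (simp add: S_def inner_commute)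
    have xS: "x \<in> S" and x0: "x \<noteq> 0" using that px by (auto simp: S_def)
    obtain w b where w: "w \<in> S" "norm w = 1" "Q *v w = b *\<^sub>R w"
        and b: "\<And>x. x \<in> S \<Longrightarrow> matrix_form Q x x \<le> b * (norm x)\<^sup>2"
      using top_eigenvector[OF Q S inv xS x0] by metis
    have bpos: "0 < b" using b[of x] that px zero_le_power2[of "norm x"]
      by (smt (verit) S_def mem_Collect_eq mult_nonneg_nonneg mult_nonpos_nonneg)
    have w0: "w \<noteq> 0" using w by auto
    have vw: "v \<bullet> w = 0" using w by (simp add: S_def)
    have cb: "c \<in> C" "b \<in> C" unfolding C_def using v(2) v0 pos w(3) w0 bpos by blast+
    have one_le: "1 \<le> dim (E a)" if "y \<in> E a" "y \<noteq> 0" for a y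
      using that dim_eq_0[of "E a"] by (metis One_nat_def Suc_leI insertE neq0_conv singletonD subset_eq)
    show False
    proof (cases "b = c")
      case True
      have "independent {v, w}"
        using v0 w0 vw by (intro pairwise_orthogonal_independent)
          (auto simp: pairwise_def orthogonal_def inner_commute)
      moreover have "v \<noteq> w" using vw v0 by auto
      ultimately have "2 \<le> dim (E c)"
        using independent_card_le_dim[of "{v, w}" "E c"] v w True by (simp add: E_def)
      moreover have "dim (E c) \<le> (\<Sum>c\<in>C. dim (E c))" using fin cb by (intro member_le_sum) auto
      ultimately show False using total by simp
    next
      case False
      have "(\<Sum>c\<in>{b, c}. dim (E c)) \<le> (\<Sum>c\<in>C. dim (E c))"
        using fin cb by (intro sum_mono2) auto
      moreover have "1 \<le> dim (E c)" "1 \<le> dim (E b)"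
        using one_le[of v c] one_le[of w b] v v0 w w0 by (auto simp: E_def)
      ultimately show False using total False by simp
    qed
  qed
  then show ?thesis
    using reversed_cauchy_schwarz_from_hyperplane[OF bilinear_matrix_form matrix_form_commute[OF Q],
        of "\<lambda>x. v \<bullet> x"] u by (simp add: linear_iff inner_add_right)
qed

text \<open>
  Two orthogonal eigenvectors with positive eigenvalues would span a plane on which \<open>Q\<close> is positive
  definite; this plane contains a vector orthogonal to \<open>u\<close> with respect to \<open>Q\<close>, where reversed
  Cauchy--Schwarz makes \<open>Q\<close> nonpositive.
\<close>

lemma one_positive_eigenvalue_if_reversed_cauchy_schwarz:
  fixes Q :: "real ^ 'n ^ 'n"
  assumes Q: "transpose Q = Q" and u: "0 < matrix_form Q u u"
    and rcs: "\<And>x. matrix_form Q u u * matrix_form Q x x \<le> (matrix_form Q u x)\<^sup>2"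
  shows "num_pos_eigenvalues Q = 1"
proof -
  note bl = bilinear_matrix_form[of Q]
  have no_two: False
    if e: "Q *v v = a *\<^sub>R v" "Q *v w = b *\<^sub>R w" "v \<noteq> 0" "w \<noteq> 0" "0 < a" "0 < b" "v \<bullet> w = 0"
    for v w a b
  proof -
    define p where "p = matrix_form Q u v"
    define r where "r = matrix_form Q u w"
    have "matrix_form Q u (r *\<^sub>R v - p *\<^sub>R w) = 0"
      by (simp add: bilinear_rsub[OF bl] bilinear_rmul[OF bl] p_def r_def)
    then have "matrix_form Q (r *\<^sub>R v - p *\<^sub>R w) (r *\<^sub>R v - p *\<^sub>R w) \<le> 0"
      using rcs[of "r *\<^sub>R v - p *\<^sub>R w"] u by (simp add: mult_le_0_iff)
    moreover have "matrix_form Q (r *\<^sub>R v - p *\<^sub>R w) (r *\<^sub>R v - p *\<^sub>R w)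
        = r\<^sup>2 * (a * (v \<bullet> v)) + p\<^sup>2 * (b * (w \<bullet> w))"
      using e(7) by (simp add: matrix_vector_mult_diff_distrib matrix_vector_mult_scaleR e(1,2)
          inner_diff_left inner_diff_right inner_commute power2_eq_square)
    moreover have "0 < a * (v \<bullet> v)" "0 < b * (w \<bullet> w)" using e by auto
    ultimately have "p = 0"
      by (smt (verit) mult_nonneg_nonneg mult_pos_pos zero_le_power2 zero_less_power2)
    with rcs[of v] u have "matrix_form Q v v \<le> 0" by (simp add: p_def mult_le_0_iff)
    then show False using e \<open>0 < a * (v \<bullet> v)\<close> by simp
  qed
  have u0: "u \<noteq> 0" using u by auto
  obtain v c where v: "norm v = 1" "Q *v v = c *\<^sub>R v"
      and c: "\<And>x. matrix_form Q x x \<le> c * (norm x)\<^sup>2"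
    using top_eigenvector[OF Q subspace_UNIV UNIV_I UNIV_I u0] by (metis UNIV_I)
  have pos: "0 < c" using c[of u] u zero_le_power2[of "norm u"]
    by (smt (verit) mult_nonneg_nonneg mult_nonpos_nonneg)
  have v0: "v \<noteq> 0" using v by auto
  have "b = c" if "0 < b" "w \<noteq> 0" "Q *v w = b *\<^sub>R w" for b w
  proof (rule ccontr)
    assume "b \<noteq> c"
    have "b * (v \<bullet> w) = c * (v \<bullet> w)"
      using matrix_form_commute[OF Q, of v w] that v by (simp add: inner_commute)
    then have "v \<bullet> w = 0" using \<open>b \<noteq> c\<close> by simp
    then show False using no_two[of v c w b] v v0 pos that by blast
  qed
  then have C: "{c. 0 < c \<and> (\<exists>v. v \<noteq> 0 \<and> Q *v v = c *\<^sub>R v)} = {c}"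
    using pos v(2) v0 by blast
  have "w \<in> span {v}" if w: "Q *v w = c *\<^sub>R w" for w
  proof -
    define y where "y = w - (v \<bullet> w) *\<^sub>R v"
    have "Q *v y = c *\<^sub>R y"
      using w v by (simp add: y_def matrix_vector_mult_diff_distrib matrix_vector_mult_scaleR algebra_simps)
    moreover have "v \<bullet> y = 0" using v by (simp add: y_def inner_diff_right norm_eq_1)
    ultimately have "y = 0" using no_two[of v c y c] v v0 pos by blast
    then show ?thesis by (simp add: y_def span_singleton)
  qed
  then have sub: "{w. Q *v w = c *\<^sub>R w} \<subseteq> span {v}" by (rule subsetI) simp
  have "span {v} \<subseteq> {w. Q *v w = c *\<^sub>R w}"
    by (rule span_minimal[OF _ eigenspace_subspace]) (simp add: v)
  with sub have "{w. Q *v w = c *\<^sub>R w} = span {v}" by (rule subset_antisym)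
  then have "dim {w. Q *v w = c *\<^sub>R w} = 1" using v0 by simp
  then show ?thesis unfolding num_pos_eigenvalues_def C by simp
qed

section \<open>Polarisation\<close>

lemma partial_deriv_commute: "partial_deriv i (partial_deriv j f) = partial_deriv j (partial_deriv i f)"
  by (cases "i = j") (auto simp: partial_deriv_def fun_upd_twist)

lemma partial_deriv_dir_deriv:
  "partial_deriv i (dir_deriv a f) = dir_deriv a (partial_deriv i f)"
  by (rule ext, subst (2) dir_deriv_def, subst partial_deriv_commute)
    (simp add: partial_deriv_def[of i] dir_deriv_def sum_distrib_left mult_ac)

lemma dir_deriv_commute: "dir_deriv a (dir_deriv b f) = dir_deriv b (dir_deriv a f)"
proof
  fix \<alpha>
  have e: "dir_deriv a (dir_deriv b f) \<alpha>
      = (\<Sum>i\<in>UNIV. \<Sum>j\<in>UNIV. a $ i * (b $ j * partial_deriv j (partial_deriv i f) \<alpha>))" for a b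
    by (simp add: dir_deriv_def[of a "dir_deriv b f"] partial_deriv_dir_deriv
        dir_deriv_def[of b "partial_deriv i f" for i] sum_distrib_left)
  show "dir_deriv a (dir_deriv b f) \<alpha> = dir_deriv b (dir_deriv a f) \<alpha>"
    unfolding e by (subst sum.swap) (simp add: partial_deriv_commute mult_ac)
qed

lemma dir_deriv_add_vec: "dir_deriv (a + b) f \<alpha> = dir_deriv a f \<alpha> + dir_deriv b f \<alpha>"
  by (simp add: dir_deriv_def algebra_simps sum.distrib)

lemma dir_deriv_scaleR_vec: "dir_deriv (c *\<^sub>R a) f \<alpha> = c * dir_deriv a f \<alpha>"
  by (simp add: dir_deriv_def sum_distrib_left mult_ac)

lemma dir_deriv_comb: "dir_deriv a (\<lambda>\<alpha>. f \<alpha> + c * g \<alpha>) = (\<lambda>\<alpha>. dir_deriv a f \<alpha> + c * dir_deriv a g \<alpha>)"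
  by (simp add: fun_eq_iff dir_deriv_def partial_deriv_def sum_distrib_left algebra_simps sum.distrib)

lemma dir_deriv_zero [simp]: "dir_deriv a (\<lambda>_. 0) = (\<lambda>_. 0)"
  by (simp add: dir_deriv_def partial_deriv_def)

lemma dir_deriv_sum: "dir_deriv a (\<lambda>\<alpha>. \<Sum>i\<in>I. c i * g i \<alpha>) = (\<lambda>\<alpha>. \<Sum>i\<in>I. c i * dir_deriv a (g i) \<alpha>)"
  by (induction I rule: infinite_finite_induct)
     (simp_all add: dir_deriv_comb[where c="c i" for i] add.commute[of "c i * g i _" for i]
       add.commute[of "c i * dir_deriv a (g i) _" for i])

lemma dir_derivs_comb:
  "dir_derivs as (\<lambda>\<alpha>. f \<alpha> + c * g \<alpha>) = (\<lambda>\<alpha>. dir_derivs as f \<alpha> + c * dir_derivs as g \<alpha>)"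
  by (induction as) (simp_all add: dir_deriv_comb)

lemma dir_derivs_zero: "dir_derivs as (\<lambda>_. 0) = (\<lambda>_. 0)"
  by (induction as) simp_all

lemma dir_derivs_dir_deriv: "dir_derivs as (dir_deriv a f) = dir_deriv a (dir_derivs as f)"
  by (induction as) (simp_all add: dir_deriv_commute)

lemma dir_derivs_permute: "mset as = mset bs \<Longrightarrow> dir_derivs as f = dir_derivs bs f"
proof -
  assume m: "mset as = mset bs"
  have c: "dir_deriv a \<circ> dir_deriv b = dir_deriv b \<circ> dir_deriv a" for a b :: "real^'a"
    by (rule ext) (simp add: dir_deriv_commute)
  have "foldr dir_deriv xs = fold dir_deriv xs" for xs :: "(real^'a) list"
    by (rule foldr_fold) (rule c)
  then show ?thesis using fold_multiset_equiv[of as dir_deriv bs, OF c m] by metis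
qed

text \<open>
  For a form of degree \<open>d\<close> and \<open>d\<close> vectors the iterated derivative is a constant, read off here as
  the coefficient of the trivial monomial.
\<close>

definition polar :: "('n::finite) polyn \<Rightarrow> (real ^ 'n) list \<Rightarrow> real" where
  "polar f as = dir_derivs as f (\<lambda>_. 0)"

lemma polar_permute: "mset as = mset bs \<Longrightarrow> polar f as = polar f bs"
  by (simp add: polar_def dir_derivs_permute[of as bs])

lemma polar_dir_deriv: "polar (dir_deriv a f) as = polar f (a # as)"
  by (simp add: polar_def dir_derivs_dir_deriv)

lemma polar_dir_derivs: "polar (dir_derivs bs f) as = polar f (as @ bs)"
  by (simp add: polar_def)

lemma polar_comb: "polar (\<lambda>\<alpha>. f \<alpha> + c * g \<alpha>) as = polar f as + c * polar g as"
  by (simp add: polar_def dir_derivs_comb)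

lemma linear_polar: "linear (\<lambda>x. polar f (x # as))"
  by (simp add: linear_iff polar_def dir_deriv_add_vec dir_deriv_scaleR_vec)

lemma polar_swap: "polar f (x # y # as) = polar f (y # x # as)"
  by (rule polar_permute) simp

lemma bilinear_polar: "bilinear (\<lambda>x y. polar f (x # y # as))"
  unfolding bilinear_def
proof (intro conjI allI)
  show "linear (\<lambda>x. polar f (x # y # as))" for y by (rule linear_polar)
  show "linear (\<lambda>y. polar f (x # y # as))" for x unfolding polar_swap[of f x] by (rule linear_polar)
qed

lemma continuous_dir_deriv:
  assumes "\<And>i. continuous_on S (\<lambda>t. a t $ i)" "\<And>\<alpha>. continuous_on S (\<lambda>t. g t \<alpha>)"
  shows "continuous_on S (\<lambda>t. dir_deriv (a t) (g t) \<alpha>)"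
  unfolding dir_deriv_def partial_deriv_def by (intro continuous_intros assms)

lemma continuous_polar_shift: "continuous_on S (\<lambda>t. polar f (map (\<lambda>a. a + t *\<^sub>R w) as))"
proof -
  have "continuous_on S (\<lambda>t. dir_derivs (map (\<lambda>a. a + t *\<^sub>R w) as) f \<alpha>)" for \<alpha>
  proof (induction as arbitrary: \<alpha>)
    case (Cons a as)
    then show ?case by (auto intro!: continuous_dir_deriv continuous_intros)
  qed simp
  then show ?thesis by (simp add: polar_def)
qed

lemma continuous_coefficient: "continuous_on S (\<lambda>f :: 'a \<Rightarrow> 'b::topological_space. f \<alpha>)"
  by (rule continuous_on_subset[OF continuous_on_product_coordinates subset_UNIV])

lemma continuous_polar: "continuous_on S (\<lambda>f. polar f as)"
proof -
  have "continuous_on S (\<lambda>f. dir_derivs as f \<alpha>)" for \<alpha>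
    by (induction as arbitrary: \<alpha>)
       (auto intro!: continuous_dir_deriv continuous_intros continuous_coefficient)
  then show ?thesis by (simp add: polar_def)
qed

lemma forms_Suc_eq_zero:
  assumes f: "f \<in> forms (Suc d)" and z: "\<And>a. dir_deriv a f = (\<lambda>_. 0)"
  shows "f = (\<lambda>_. 0)"
proof (rule ext, rule ccontr)
  fix \<alpha> assume n: "f \<alpha> \<noteq> 0"
  then have "(\<Sum>i\<in>UNIV. \<alpha> i) = Suc d" using f by (auto simp: forms_def)
  then obtain i where i: "\<alpha> i \<noteq> 0" by (metis nat.distinct(1) sum.neutral)
  have "partial_deriv i f (\<alpha>(i := \<alpha> i - 1)) = 0"
    using fun_cong[OF z[of "axis i 1"], of "\<alpha>(i := \<alpha> i - 1)"]
    by (simp add: dir_deriv_def axis_def if_distrib[where f = "\<lambda>u. u * _"] cong: if_cong)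
  then show False using n i by (simp add: partial_deriv_def)
qed

lemma forms_0_eq_zero:
  assumes "f \<in> forms 0" "f (\<lambda>_. 0) = 0" shows "f = (\<lambda>_. 0)"
proof (rule ext, rule ccontr)
  fix \<alpha> assume n: "f \<alpha> \<noteq> 0"
  then have "\<alpha> = (\<lambda>_. 0)" using assms by (auto simp: forms_def)
  then show False using n assms by simp
qed

text \<open>
  From an interior point one can move a little in the directions \<open>x\<close> and \<open>- x\<close>.
\<close>

lemma linear_nonneg_zero_at_interior:
  fixes h :: "'a::euclidean_space \<Rightarrow> real"
  assumes h: "linear h" and pos: "\<And>x. x \<in> S \<Longrightarrow> 0 \<le> h x" and a: "a \<in> interior S" "h a = 0"
  shows "h x = 0"
proof -
  obtain e where e: "0 < e" "ball a e \<subseteq> S" using a by (meson mem_interior)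
  define t where "t = e / (2 * (norm x + 1))"
  have t: "0 < t" using e by (simp add: t_def add_nonneg_pos)
  have "t * norm x = e * (norm x / (2 * (norm x + 1)))" by (simp add: t_def)
  also have "\<dots> < e * 1" using e by (intro mult_strict_left_mono) (simp_all add: add_nonneg_pos)
  finally have t': "t * norm x < e" by simp
  have "a + t *\<^sub>R x \<in> S" "a - t *\<^sub>R x \<in> S" using e t t' by (auto simp: subset_iff dist_norm)
  from pos[OF this(1)] pos[OF this(2)] t a(2) show ?thesis
    by (simp add: linear_add[OF h] linear_diff[OF h] linear_scale[OF h] zero_le_mult_iff mult_le_0_iff)
qed

text \<open>
  A single zero at a tuple of interior points propagates: freeing the first argument gives a linear
  form that vanishes identically, so for each interior \<open>b\<close> the derivative \<open>D\<^sub>b f\<close> has such a zero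
  as well and is \<open>0\<close> by induction; since \<open>D\<^sub>b f\<close> is linear in \<open>b\<close>, all derivatives of \<open>f\<close> vanish.
  Hence strict positivity can be lost in a limit of Lorentzian forms only if the limit is zero.
\<close>

lemma form_zero_if_polar_zero_at_interior:
  assumes "f \<in> forms d" and "\<And>as. length as = d \<Longrightarrow> set as \<subseteq> interior S \<Longrightarrow> 0 \<le> polar f as"
    and "length as = d" "set as \<subseteq> interior S" "polar f as = 0"
  shows "f = (\<lambda>_. 0)"
  using assms
proof (induction d arbitrary: f as)
  case 0
  then show ?case by (intro forms_0_eq_zero) (auto simp: polar_def)
next
  case (Suc d)
  obtain a bs where as: "as = a # bs" "length bs = d" using Suc.prems(3) by (cases as) auto
  have "polar f (x # bs) = 0" for x
    by (rule linear_nonneg_zero_at_interior[OF linear_polar, where S = "interior S" and a = a])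
       (use Suc.prems as in auto)
  then have b: "dir_deriv b f = (\<lambda>_. 0)" if "b \<in> interior S" for b
    using Suc.prems as that
    by (intro Suc.IH[of "dir_deriv b f" bs] dir_deriv_forms) (auto simp: polar_dir_deriv)
  show ?case
  proof (rule forms_Suc_eq_zero[OF Suc.prems(1)], rule ext)
    fix x \<alpha>
    show "dir_deriv x f \<alpha> = 0"
      by (rule linear_nonneg_zero_at_interior[of "\<lambda>x. dir_deriv x f \<alpha>" "interior S" a])
         (use b Suc.prems as in \<open>auto simp: linear_iff dir_deriv_add_vec dir_deriv_scaleR_vec\<close>)
  qed
qed

section \<open>The quadratic form and its matrix\<close>

lemma dir_derivs_in_forms_2: "d \<ge> 2 \<Longrightarrow> length as + 2 = d \<Longrightarrow> f \<in> forms d \<Longrightarrow> dir_derivs as f \<in> forms 2"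
  by (rule dir_derivs_forms) (simp add: add.commute)

lemma poly_eval_forms:
  assumes "f \<in> forms d"
  shows "poly_eval f x = (\<Sum>\<alpha> | sum \<alpha> UNIV = d. f \<alpha> * (\<Prod>i\<in>UNIV. (x $ i) ^ \<alpha> i))"
  unfolding poly_eval_def
  using assms by (intro sum.mono_neutral_left finite_multi_indices) (auto simp: forms_def)

lemma sum_upd_multi_index: "sum (\<alpha>(i := k)) UNIV + \<alpha> i = sum \<alpha> (UNIV::'n::finite set) + (k::nat)"
  by (simp add: sum.remove[of UNIV i])

lemma prod_upd_multi_index:
  "(\<Prod>j\<in>UNIV. (x $ j) ^ (\<alpha>(i := \<alpha> i + 1)) j) = x $ i * (\<Prod>j\<in>UNIV. ((x :: real ^ 'n) $ j) ^ \<alpha> j)"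
proof -
  have "(\<Prod>j\<in>UNIV - {i}. (x $ j) ^ (\<alpha>(i := \<alpha> i + 1)) j) = (\<Prod>j\<in>UNIV - {i}. (x $ j) ^ \<alpha> j)"
    by (rule prod.cong) auto
  then show ?thesis by (simp add: prod.remove[of UNIV i])
qed

text \<open>
  Comparison of coefficients: the monomial \<open>\<alpha>\<close> of \<open>f\<close> contributes \<open>\<alpha> i\<close> times to the \<open>i\<close>-th summand
  of \<open>D\<^sub>x f\<close> evaluated at \<open>x\<close>.
\<close>

lemma euler_identity:
  fixes f :: "('n::finite) polyn"
  assumes f: "f \<in> forms (Suc d)"
  shows "poly_eval (dir_deriv x f) x = real (Suc d) * poly_eval f x"
proof -
  let ?m = "\<lambda>\<alpha>. \<Prod>j\<in>UNIV. (x $ j) ^ \<alpha> j"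
  have re: "(\<Sum>\<beta> | sum \<beta> (UNIV::'n set) = d. x $ i * partial_deriv i f \<beta> * ?m \<beta>)
      = (\<Sum>\<alpha> | sum \<alpha> (UNIV::'n set) = Suc d. real (\<alpha> i) * f \<alpha> * ?m \<alpha>)" for i
  proof -
    have "(\<Sum>\<beta> | sum \<beta> (UNIV::'n set) = d. x $ i * partial_deriv i f \<beta> * ?m \<beta>)
      = (\<Sum>\<alpha> | sum \<alpha> (UNIV::'n set) = Suc d \<and> \<alpha> i \<noteq> 0. real (\<alpha> i) * f \<alpha> * ?m \<alpha>)"
    proof (rule sum.reindex_bij_witness[of _ "\<lambda>\<alpha>. \<alpha>(i := \<alpha> i - 1)" "\<lambda>\<beta>. \<beta>(i := \<beta> i + 1)"])
      fix \<beta> :: "'n \<Rightarrow> nat" assume "\<beta> \<in> {\<beta>. sum \<beta> UNIV = d}"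
      then show "\<beta>(i := \<beta> i + 1) \<in> {\<alpha>. sum \<alpha> UNIV = Suc d \<and> \<alpha> i \<noteq> 0}"
        using sum_upd_multi_index[of \<beta> i "\<beta> i + 1"] by simp
      show "real ((\<beta>(i := \<beta> i + 1)) i) * f (\<beta>(i := \<beta> i + 1)) * ?m (\<beta>(i := \<beta> i + 1)) =
          x $ i * partial_deriv i f \<beta> * ?m \<beta>"
        unfolding prod_upd_multi_index by (simp add: partial_deriv_def)
    next
      fix \<alpha> :: "'n \<Rightarrow> nat" assume "\<alpha> \<in> {\<alpha>. sum \<alpha> UNIV = Suc d \<and> \<alpha> i \<noteq> 0}"
      then show "\<alpha>(i := \<alpha> i - 1) \<in> {\<beta>. sum \<beta> UNIV = d}"
        using sum_upd_multi_index[of \<alpha> i "\<alpha> i - 1"] by simp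
    qed auto
    also have "\<dots> = (\<Sum>\<alpha> | sum \<alpha> (UNIV::'n set) = Suc d. real (\<alpha> i) * f \<alpha> * ?m \<alpha>)"
      by (intro sum.mono_neutral_left finite_multi_indices) auto
    finally show ?thesis .
  qed
  have deg: "(\<Sum>i\<in>UNIV. real (\<alpha> i) * f \<alpha> * ?m \<alpha>) = real (sum \<alpha> UNIV) * (f \<alpha> * ?m \<alpha>)" for \<alpha>
    by (simp add: sum_distrib_right mult.assoc)
  have "poly_eval (dir_deriv x f) x
      = (\<Sum>\<beta> | sum \<beta> (UNIV::'n set) = d. \<Sum>i\<in>UNIV. x $ i * partial_deriv i f \<beta> * ?m \<beta>)"
    unfolding poly_eval_forms[OF dir_deriv_forms[OF f]] by (simp add: dir_deriv_def sum_distrib_right)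
  also have "\<dots> = (\<Sum>i\<in>UNIV. \<Sum>\<alpha> | sum \<alpha> UNIV = Suc d. real (\<alpha> i) * f \<alpha> * ?m \<alpha>)"
    by (subst sum.swap) (simp add: re)
  also have "\<dots> = (\<Sum>\<alpha> | sum \<alpha> (UNIV::'n set) = Suc d. real (sum \<alpha> UNIV) * (f \<alpha> * ?m \<alpha>))"
    by (subst sum.swap) (simp only: deg)
  also have "\<dots> = real (Suc d) * poly_eval f x"
    by (simp add: poly_eval_forms[OF f] sum_distrib_left)
  finally show ?thesis .
qed

lemma poly_eval_forms_0:
  assumes "f \<in> forms 0" shows "poly_eval f x = f (\<lambda>_. 0)"
proof -
  have "{\<alpha>. sum \<alpha> (UNIV::'a set) = (0::nat)} = {\<lambda>_. 0}" by auto
  then show ?thesis by (simp add: poly_eval_forms[OF assms])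
qed

lemma poly_eval_forms_2:
  assumes q: "q \<in> forms 2" shows "poly_eval q x = polar q [x, x] / 2"
proof -
  have 2: "q \<in> forms (Suc (Suc 0))" using q by (simp add: numeral_2_eq_2)
  note 1 = dir_deriv_forms[OF 2, of x]
  show ?thesis
    using euler_identity[OF 2, of x] euler_identity[OF 1, of x]
      poly_eval_forms_0[OF dir_deriv_forms[OF 1, of x], of x]
    by (simp add: polar_def)
qed

lemma quad_matrix_properties:
  assumes q: "q \<in> forms 2"
  shows transpose_quad_matrix: "transpose (quad_matrix q) = quad_matrix q"
    and quad_matrix_polar: "x \<bullet> (quad_matrix q *v y) = polar q [x, y] / 2"
proof -
  let ?Q = "quad_matrix q"
  have Q: "transpose ?Q = ?Q \<and> (\<forall>x. poly_eval q x = x \<bullet> (?Q *v x))"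
    unfolding quad_matrix_def by (rule theI'[OF quad_matrix_ex1[OF q]])
  then show "transpose ?Q = ?Q" by simp
  note c = matrix_form_commute[OF this]
  have e: "matrix_form ?Q x x = polar q [x, x] / 2" for x
    using Q poly_eval_forms_2[OF q] by simp
  note P = bilinear_polar[of q "[]"] and M = bilinear_matrix_form[of ?Q]
  show "x \<bullet> (?Q *v y) = polar q [x, y] / 2"
    using e[of "x + y"] e[of x] e[of y] c[of x y] polar_swap[of q x y "[]"]
    by (simp add: bilinear_ladd[OF P] bilinear_radd[OF P] bilinear_ladd[OF M] bilinear_radd[OF M])
qed

section \<open>Powers of linear forms and the Nuij operator\<close>

text \<open>
  The form \<open>(l \<bullet> x) ^ d / d!\<close>: the factor \<open>1 / d!\<close> turns the multinomial coefficients into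
  reciprocals of factorials and the derivative rule into \<open>D\<^sub>a (l\<^sup>d / d!) = (l \<bullet> a) l\<^sup>d\<^sup>-\<^sup>1 / (d - 1)!\<close>.
\<close>

definition divided_power :: "real ^ 'n \<Rightarrow> nat \<Rightarrow> ('n::finite) polyn" where
  "divided_power l d \<alpha> = (if sum \<alpha> UNIV = d then \<Prod>i\<in>UNIV. (l $ i) ^ \<alpha> i / fact (\<alpha> i) else 0)"

lemma divided_power_forms: "divided_power l d \<in> forms d"
  by (simp add: forms_def divided_power_def)

lemma dir_deriv_divided_power:
  "dir_deriv a (divided_power l (Suc d)) = (\<lambda>\<alpha>. (l \<bullet> a) * divided_power l d \<alpha>)"
proof -
  have "partial_deriv i (divided_power l (Suc d)) \<alpha> = l $ i * divided_power l d \<alpha>" for i \<alpha>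
  proof -
    have "(\<Prod>j\<in>UNIV - {i}. (l $ j) ^ (\<alpha>(i := \<alpha> i + 1)) j / fact ((\<alpha>(i := \<alpha> i + 1)) j))
        = (\<Prod>j\<in>UNIV - {i}. (l $ j) ^ \<alpha> j / fact (\<alpha> j))"
      by (rule prod.cong) auto
    then show ?thesis
      using sum_upd_multi_index[of \<alpha> i "\<alpha> i + 1"]
      by (simp add: partial_deriv_def divided_power_def prod.remove[of UNIV i] divide_simps)
  qed
  then show ?thesis
    by (simp add: fun_eq_iff dir_deriv_def inner_vec_def sum_distrib_right sum_distrib_left mult_ac)
qed

lemma polar_scale: "polar (\<lambda>\<alpha>. c * f \<alpha>) as = c * polar f as"
  using polar_comb[of "\<lambda>_. 0" c f as] by (simp add: polar_def dir_derivs_zero)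

lemma polar_divided_power:
  "length as = d \<Longrightarrow> polar (divided_power l d) as = (\<Prod>a\<leftarrow>as. l \<bullet> a)"
proof (induction as arbitrary: d)
  case Nil
  then show ?case by (simp add: polar_def divided_power_def)
next
  case (Cons a as)
  then show ?case
    by (auto simp: polar_dir_deriv[symmetric] dir_deriv_divided_power polar_scale)
qed

definition linear_mult :: "real ^ 'n \<Rightarrow> ('n::finite) polyn \<Rightarrow> 'n polyn" where
  "linear_mult l f = (\<lambda>\<alpha>. \<Sum>i\<in>UNIV. if \<alpha> i = 0 then 0 else l $ i * f (\<alpha>(i := \<alpha> i - 1)))"

lemma linear_mult_forms:
  assumes "f \<in> forms d" shows "linear_mult l f \<in> forms (Suc d)"
proof -
  have "sum \<alpha> UNIV = Suc d" if "linear_mult l f \<alpha> \<noteq> 0" for \<alpha>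
  proof -
    obtain i where "(if \<alpha> i = 0 then 0 else l $ i * f (\<alpha>(i := \<alpha> i - 1))) \<noteq> 0"
      using \<open>linear_mult l f \<alpha> \<noteq> 0\<close> unfolding linear_mult_def
      by (rule sum.not_neutral_contains_not_neutral)
    then have i: "\<alpha> i \<noteq> 0" "f (\<alpha>(i := \<alpha> i - 1)) \<noteq> 0" by (auto split: if_splits)
    then have "sum (\<alpha>(i := \<alpha> i - 1)) UNIV = d" using assms unfolding forms_def by blast
    then show ?thesis using sum_upd_multi_index[of \<alpha> i "\<alpha> i - 1"] i by simp
  qed
  then show ?thesis by (simp add: forms_def)
qed

lemma linear_mult_zero [simp]: "linear_mult l (\<lambda>_. 0) = (\<lambda>_. 0)"
  by (rule ext) (simp add: linear_mult_def cong: if_cong)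

lemma dir_deriv_linear_mult:
  "dir_deriv a (linear_mult l f) = (\<lambda>\<alpha>. (l \<bullet> a) * f \<alpha> + linear_mult l (dir_deriv a f) \<alpha>)"
proof -
  have p: "partial_deriv j (linear_mult l f) \<alpha> = l $ j * f \<alpha> + linear_mult l (partial_deriv j f) \<alpha>" for j \<alpha>
  proof -
    let ?r = "\<Sum>i\<in>UNIV - {j}. if \<alpha> i = 0 then 0
        else l $ i * partial_deriv j f (\<alpha>(i := \<alpha> i - 1))"
    have "partial_deriv j (linear_mult l f) \<alpha> = real (\<alpha> j + 1) * (l $ j * f \<alpha>)
       + (\<Sum>i\<in>UNIV - {j}. if \<alpha> i = 0 then 0
            else real (\<alpha> j + 1) * (l $ i * f ((\<alpha>(j := \<alpha> j + 1))(i := \<alpha> i - 1))))"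
      by (simp add: partial_deriv_def linear_mult_def sum.remove[of UNIV j] sum_distrib_left
          distrib_left if_distrib cong: if_cong)
    also have "(\<Sum>i\<in>UNIV - {j}. if \<alpha> i = 0 then 0
            else real (\<alpha> j + 1) * (l $ i * f ((\<alpha>(j := \<alpha> j + 1))(i := \<alpha> i - 1)))) = ?r"
      by (rule sum.cong) (auto simp: partial_deriv_def fun_upd_twist)
    also have "linear_mult l (partial_deriv j f) \<alpha>
        = (if \<alpha> j = 0 then 0 else l $ j * partial_deriv j f (\<alpha>(j := \<alpha> j - 1))) + ?r"
      by (simp add: linear_mult_def sum.remove[of UNIV j])
    moreover have "(if \<alpha> j = 0 then 0 else l $ j * partial_deriv j f (\<alpha>(j := \<alpha> j - 1)))
        = real (\<alpha> j) * (l $ j * f \<alpha>)"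
      by (simp add: partial_deriv_def)
    ultimately show ?thesis by (simp add: algebra_simps)
  qed
  have "dir_deriv a (linear_mult l f) \<alpha> = (l \<bullet> a) * f \<alpha> + linear_mult l (dir_deriv a f) \<alpha>" for \<alpha>
  proof -
    have "(\<Sum>j\<in>UNIV. a $ j * linear_mult l (partial_deriv j f) \<alpha>) = linear_mult l (dir_deriv a f) \<alpha>"
      unfolding linear_mult_def dir_deriv_def sum_distrib_left
      by (subst sum.swap) (auto intro!: sum.cong simp: sum_distrib_left mult_ac)
    then show ?thesis
      by (simp add: dir_deriv_def[of a "linear_mult l f"] p distrib_left sum.distrib inner_vec_def
          sum_distrib_right sum_distrib_left mult_ac)
  qed
  then show ?thesis by (simp add: fun_eq_iff)
qed

text \<open>
  The operator \<open>1 + s l D\<^sub>w\<close>, which Nuij used to approximate hyperbolic polynomials by strictly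
  hyperbolic ones.
\<close>

definition nuij :: "real ^ 'n \<Rightarrow> real \<Rightarrow> real ^ 'n \<Rightarrow> ('n::finite) polyn \<Rightarrow> 'n polyn" where
  "nuij w s l f = (\<lambda>\<alpha>. f \<alpha> + s * linear_mult l (dir_deriv w f) \<alpha>)"

lemma nuij_forms:
  assumes "f \<in> forms d" "0 < d" shows "nuij w s l f \<in> forms d"
proof -
  have "linear_mult l (dir_deriv w f) \<in> forms d"
    using assms linear_mult_forms dir_deriv_forms by (metis Suc_pred)
  then show ?thesis using assms by (auto simp: forms_def nuij_def) (metis add_0 mult_zero_right)
qed

lemma dir_derivs_linear_mult:
  "dir_derivs as (linear_mult l (dir_deriv w f)) = (\<lambda>\<alpha>. linear_mult l (dir_derivs (w # as) f) \<alpha>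
     + (\<Sum>i<length as. (l \<bullet> as ! i) * dir_derivs (as[i := w]) f \<alpha>))"
proof (induction as)
  case (Cons a as)
  have "dir_derivs (a # as) (linear_mult l (dir_deriv w f)) =
    (\<lambda>\<alpha>. dir_deriv a (linear_mult l (dir_derivs (w # as) f)) \<alpha> +
      1 * dir_deriv a (\<lambda>\<alpha>. \<Sum>i<length as. (l \<bullet> as ! i) * dir_derivs (as[i := w]) f \<alpha>) \<alpha>)"
    unfolding dir_deriv_comb[symmetric] by (simp add: Cons)
  then show ?case
    unfolding dir_deriv_sum dir_deriv_linear_mult
    by (simp add: fun_eq_iff sum.lessThan_Suc_shift dir_deriv_commute[of a w] del: sum.lessThan_Suc)
qed simp

lemma dir_deriv_forms_0:
  assumes "f \<in> forms 0" shows "dir_deriv a f = (\<lambda>_. 0)"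
proof -
  have "f (\<alpha>(i := Suc (\<alpha> i))) = 0" for \<alpha> i
    using assms by (auto simp: forms_def) (metis fun_upd_same nat.distinct(1))
  then show ?thesis by (simp add: dir_deriv_def partial_deriv_def)
qed

text \<open>
  On polarisations the operator acts as a derivation: \<open>T\<close> is changed by the sum over all ways to
  replace one argument \<open>a\<close> by \<open>w\<close>, weighted with \<open>l \<bullet> a\<close>. The remaining term of the Leibniz rule
  contains a derivative of order \<open>d + 1\<close> and vanishes.
\<close>

lemma polar_nuij:
  assumes "f \<in> forms d" "length as = d"
  shows "polar (nuij w s l f) as = polar f as + s * (\<Sum>i<d. (l \<bullet> as ! i) * polar f (as[i := w]))"
  using dir_deriv_forms_0[OF dir_derivs_forms[of f 0 as], of w] assms
  unfolding nuij_def polar_comb by (simp add: polar_def dir_derivs_linear_mult)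

lemma polar_nuij_pair:
  assumes "f \<in> forms d" "length as + 2 = d"
  shows "polar (nuij w s l f) (x # y # as) = polar f (x # y # as)
    + s * ((l \<bullet> x) * polar f (w # y # as) + (l \<bullet> y) * polar f (w # x # as)
      + (\<Sum>j<length as. (l \<bullet> as ! j) * polar f (x # y # as[j := w])))"
proof -
  have d: "d = Suc (Suc (length as))" using assms by simp
  show ?thesis
    using polar_nuij[OF assms(1), of "x # y # as" w s l] polar_swap[of f x w as]
    by (simp add: d sum.lessThan_Suc_shift del: sum.lessThan_Suc)
qed

lemma nuij_zero_step [simp]: "nuij w 0 l f = f"
  by (simp add: nuij_def)

lemma continuous_nuij:
  assumes "\<And>\<alpha>. continuous_on S (\<lambda>s. g s \<alpha>)"
  shows "continuous_on S (\<lambda>s. nuij w s l (g s) \<alpha>)"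
proof -
  have "continuous_on S (\<lambda>s. linear_mult l (dir_deriv w (g s)) \<alpha>)"
    unfolding linear_mult_def
  proof (rule continuous_on_sum)
    fix i
    show "continuous_on S (\<lambda>s. if \<alpha> i = 0 then 0
      else l $ i * dir_deriv w (g s) (\<alpha>(i := \<alpha> i - 1)))"
      by (cases "\<alpha> i = 0") (auto intro!: continuous_intros continuous_dir_deriv assms)
  qed
  then show ?thesis unfolding nuij_def by (intro continuous_intros assms)
qed

section \<open>Limits and compactness\<close>

lemma nonneg_at_zero:
  fixes g :: "real \<Rightarrow> real"
  assumes "continuous_on UNIV g" "\<And>t. 0 < t \<Longrightarrow> 0 \<le> g t"
  shows "0 \<le> g 0"
proof -
  have "(g \<longlongrightarrow> g 0) (at_right 0)"
    using assms(1) by (metis UNIV_I continuous_on_def tendsto_within_subset subset_UNIV)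
  moreover have "eventually (\<lambda>t. 0 \<le> g t) (at_right 0)"
    using assms(2) eventually_at_right_less[of "0::real"] by (auto elim: eventually_mono)
  ultimately show ?thesis using tendsto_lowerbound trivial_limit_at_right_real by blast
qed

lemma continuous_polar_intro:
  assumes "\<And>\<alpha>. continuous_on S (\<lambda>t. g t \<alpha>)" "continuous_on S x" "continuous_on S y"
  shows "continuous_on S (\<lambda>t. polar (g t) [x t, y t])"
  unfolding polar_def foldr.simps comp_def id_def
  by (intro continuous_dir_deriv continuous_intros assms)

lemma open_forall_compact:
  fixes C :: "'a::topological_space set"
  assumes "compact C" "open W"
  shows "open {x. \<forall>y\<in>C. (x, y) \<in> W}"
proof (subst open_subopen, rule ballI)
  fix x assume "x \<in> {x. \<forall>y\<in>C. (x, y) \<in> W}"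
  then have "{x} \<times> C \<subseteq> W" by auto
  from Elementary_Topology.tube_lemma[OF assms this]
  show "\<exists>T. open T \<and> x \<in> T \<and> T \<subseteq> {x. \<forall>y\<in>C. (x, y) \<in> W}" by blast
qed

section \<open>Proper cones\<close>

text \<open>
  A proper convex combination of nonzero vectors of \<open>K\<close> that vanishes would exhibit a nonzero
  vector of \<open>K\<close> whose negative is in \<open>K\<close>.
\<close>

lemma convex_cone_minus_zero:
  assumes "proper_convex_cone K" shows "convex (K - {0})"
proof -
  have K: "convex_cone K" "K \<inter> uminus ` K = {0}" using assms by (auto simp: proper_convex_cone_def)
  show ?thesis
  proof (rule convexI)
    fix x y :: "real^'a" and u v :: real
    assume h: "x \<in> K - {0}" "y \<in> K - {0}" "0 \<le> u" "0 \<le> v" "u + v = 1"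
    have "u *\<^sub>R x + v *\<^sub>R y \<in> K" using K h by (auto simp: convex_cone_iff)
    moreover have "u *\<^sub>R x + v *\<^sub>R y \<noteq> 0"
    proof
      assume z: "u *\<^sub>R x + v *\<^sub>R y = 0"
      show False
      proof (cases "u = 0")
        case False
        have "u *\<^sub>R x = - (v *\<^sub>R y)" using z by (simp add: eq_neg_iff_add_eq_0)
        moreover have "u *\<^sub>R x \<in> K" "v *\<^sub>R y \<in> K" using K h by (auto simp: convex_cone_iff)
        ultimately have "u *\<^sub>R x \<in> K \<inter> uminus ` K" by blast
        then show False using K(2) False h by auto
      qed (use z h in auto)
    qed
    ultimately show "u *\<^sub>R x + v *\<^sub>R y \<in> K - {0}" by simp
  qed
qed

text \<open>
  The functionals that are positive on \<open>K - {0}\<close> span the dual space. One functional \<open>l\<close> comes from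
  separating \<open>0\<close> from the convex hull of the compact base \<open>K \<inter> sphere 0 1\<close>; it satisfies
  \<open>b * norm a < l \<bullet> a\<close> for some \<open>b > 0\<close>, so it stays positive when \<open>b\<close> times any coordinate
  functional is added.
\<close>

lemma separating_functionals:
  fixes K :: "(real ^ 'n) set"
  assumes "proper_convex_cone K"
  obtains L :: "(real ^ 'n) list" where "\<And>l a. l \<in> set L \<Longrightarrow> a \<in> K - {0} \<Longrightarrow> 0 < l \<bullet> a"
    and "\<And>z. (\<And>l. l \<in> set L \<Longrightarrow> l \<bullet> z = 0) \<Longrightarrow> z = 0" and "L \<noteq> []"
proof -
  have K: "convex_cone K" "closed K" using assms by (auto simp: proper_convex_cone_def)
  let ?C = "K \<inter> sphere 0 1"
  have "compact ?C" using K by (simp add: closed_Int_compact)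
  then have cl: "closed (convex hull ?C)" by (simp add: compact_convex_hull compact_imp_closed)
  have "convex hull ?C \<subseteq> K - {0}"
    by (rule hull_minimal) (use convex_cone_minus_zero[OF assms] in auto)
  then have "0 \<notin> convex hull ?C" by blast
  from separating_hyperplane_closed_0[OF convex_convex_hull cl this]
  obtain l b where b: "0 < b" "\<And>x. x \<in> convex hull ?C \<Longrightarrow> b < l \<bullet> x" by blast
  have lower: "b * norm a < l \<bullet> a" if "a \<in> K - {0}" for a
  proof -
    have "(1 / norm a) *\<^sub>R a \<in> ?C" using that K by (simp add: convex_cone_iff)
    then have "b < l \<bullet> ((1 / norm a) *\<^sub>R a)" by (intro b(2) hull_inc)
    then show ?thesis using that by (simp add: field_simps)
  qed
  obtain xs :: "'n list" where xs: "set xs = UNIV" using finite_list[of "UNIV::'n set"] by auto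
  define L where "L = l # map (\<lambda>i. l + b *\<^sub>R axis i 1) xs"
  show ?thesis
  proof (rule that[of L])
    fix m a assume m: "m \<in> set L" and a: "a \<in> K - {0}"
    have "0 < l \<bullet> a" using lower[OF a] b(1) by (smt (verit) mult_nonneg_nonneg norm_ge_zero)
    moreover have "0 < l \<bullet> a + b * a $ i" for i
    proof -
      have "- (b * a $ i) \<le> b * norm a"
        using b(1) component_le_norm_cart[of a i] mult_left_mono[of "- (a $ i)" "norm a" b] by auto
      then show ?thesis using lower[OF a] by linarith
    qed
    ultimately show "0 < m \<bullet> a" using m by (auto simp: L_def inner_add_left inner_axis')
  next
    fix z assume z: "\<And>m. m \<in> set L \<Longrightarrow> m \<bullet> z = 0"
    have "l \<bullet> z = 0" using z by (simp add: L_def)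
    moreover have "(l + b *\<^sub>R axis i 1) \<bullet> z = 0" for i by (rule z) (use xs in \<open>auto simp: L_def\<close>)
    ultimately have "z $ i = 0" for i using b(1) by (simp add: inner_add_left inner_axis')
    then show "z = 0" by (simp add: vec_eq_iff)
  qed (simp add: L_def)
qed

text \<open>
  The interior point \<open>w\<close> serves three purposes: it moves boundary points of \<open>K\<close> into the interior,
  it is the vector at which signatures are tested, and it is the direction of the Nuij operator.
\<close>

locale cone_with_interior_point =
  fixes K :: "(real ^ 'n) set" and w :: "real ^ 'n"
  assumes proper: "proper_convex_cone K" and w_interior: "w \<in> interior K"
begin

lemma cone_add: "x \<in> K \<Longrightarrow> y \<in> K \<Longrightarrow> x + y \<in> K"
  and cone_scale: "x \<in> K \<Longrightarrow> 0 \<le> c \<Longrightarrow> c *\<^sub>R x \<in> K"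
  using proper by (auto simp: proper_convex_cone_def convex_cone_iff)

lemma interior_shift:
  assumes a: "a \<in> K" and t: "0 < t" shows "a + t *\<^sub>R w \<in> interior K"
proof (rule interiorI)
  show "open ((\<lambda>x. a + t *\<^sub>R x) ` interior K)" using t by (intro open_affinity) auto
  show "a + t *\<^sub>R w \<in> (\<lambda>x. a + t *\<^sub>R x) ` interior K" using w_interior by blast
  show "(\<lambda>x. a + t *\<^sub>R x) ` interior K \<subseteq> K"
    using a t interior_subset[of K] by (auto intro!: cone_add cone_scale)
qed

lemma interior_nonzero: "interior K \<subseteq> K - {0}"
proof -
  have "0 \<notin> interior K"
  proof
    assume "0 \<in> interior K"
    then obtain e where e: "0 < e" "ball 0 e \<subseteq> K" by (meson mem_interior)
    define x :: "real^'n" where "x = (e/2) *\<^sub>R axis undefined 1"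
    have n: "norm x = e/2" using e by (simp add: x_def norm_axis_1)
    then have "x \<in> K" "- x \<in> K" using e by (auto simp: subset_iff)
    then have "x \<in> K \<inter> uminus ` K" by force
    then have "x = 0" using proper unfolding proper_convex_cone_def by blast
    then show False using e n by simp
  qed
  then show ?thesis using interior_subset by blast
qed

lemma w_cone: "w \<in> K" "w \<in> K - {0}" using w_interior interior_nonzero by auto

section \<open>The closed cone of Lorentzian forms\<close>

text \<open>
  Weak inequalities are enough: for \<open>f \<noteq> 0\<close> the polarisation is automatically positive on
  interior tuples, and then reversed Cauchy--Schwarz at the single vector \<open>w\<close> determines the
  signature.
\<close>

lemma lorentzianI:
  assumes f: "f \<in> forms d" and d: "2 \<le> d"
    and nn: "\<And>as. length as = d \<Longrightarrow> set as \<subseteq> interior K \<Longrightarrow> 0 \<le> polar f as"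
    and rcs: "\<And>as x. length as + 2 = d \<Longrightarrow> set as \<subseteq> interior K \<Longrightarrow>
      polar f (w # w # as) * polar f (x # x # as) \<le> (polar f (w # x # as))\<^sup>2"
  shows "f \<in> lorentzian_forms d K"
proof (cases "f = (\<lambda>_. 0)")
  case False
  have pos: "0 < polar f as" if "length as = d" "set as \<subseteq> interior K" for as
    using form_zero_if_polar_zero_at_interior[OF f nn that] nn[OF that] False by force
  have "num_pos_eigenvalues Q = 1 \<and> (\<forall>x\<in>interior K. \<forall>y\<in>interior K. 0 < y \<bullet> (Q *v x))"
    if as: "length as = d - 2" "set as \<subseteq> interior K" and Qd: "Q = quad_matrix (dir_derivs as f)" for as Q
  proof -
    have len: "length as + 2 = d" using as d by simp
    note q = dir_derivs_in_forms_2[OF d len f]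
    have m: "x \<bullet> (Q *v y) = polar f (x # y # as) / 2" for x y
      by (simp add: Qd quad_matrix_polar[OF q] polar_dir_derivs)
    have "num_pos_eigenvalues Q = 1"
    proof (rule one_positive_eigenvalue_if_reversed_cauchy_schwarz)
      show "transpose Q = Q" unfolding Qd by (rule transpose_quad_matrix[OF q])
      show "0 < w \<bullet> (Q *v w)" using pos[of "w # w # as"] len as w_interior by (simp add: m)
      show "w \<bullet> (Q *v w) * (x \<bullet> (Q *v x)) \<le> (w \<bullet> (Q *v x))\<^sup>2" for x
        using rcs[OF len as(2), of x] by (simp add: m power_divide)
    qed
    moreover have "0 < y \<bullet> (Q *v x)" if "x \<in> interior K" "y \<in> interior K" for x y
      using pos[of "y # x # as"] len as that by (simp add: m)
    ultimately show ?thesis by blast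
  qed
  then show ?thesis using f by (simp add: lorentzian_forms_def Let_def)
qed (use f in \<open>simp add: lorentzian_forms_def\<close>)

lemma lorentzian_in_forms: "f \<in> lorentzian_forms d K \<Longrightarrow> f \<in> forms d"
  by (simp add: lorentzian_forms_def)

lemma lorentzian_matrix:
  assumes f: "f \<in> lorentzian_forms d K" "f \<noteq> (\<lambda>_. 0)" and d: "2 \<le> d"
    and as: "length as + 2 = d" "set as \<subseteq> interior K"
  obtains Q where "transpose Q = Q" "\<And>x y. x \<bullet> (Q *v y) = polar f (x # y # as) / 2"
    "num_pos_eigenvalues Q = 1"
    "\<And>x y. x \<in> interior K \<Longrightarrow> y \<in> interior K \<Longrightarrow> 0 < polar f (x # y # as)"
proof -
  define Q where "Q = quad_matrix (dir_derivs as f)"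
  note q = dir_derivs_in_forms_2[OF d as(1) lorentzian_in_forms[OF f(1)]]
  have m: "x \<bullet> (Q *v y) = polar f (x # y # as) / 2" for x y
    by (simp add: Q_def quad_matrix_polar[OF q] polar_dir_derivs)
  have "length as = d - 2" using as by simp
  then have "num_pos_eigenvalues Q = 1 \<and> (\<forall>x\<in>interior K. \<forall>y\<in>interior K. 0 < y \<bullet> (Q *v x))"
    using f as unfolding lorentzian_forms_def Q_def Let_def by blast
  then show ?thesis using that[of Q] m transpose_quad_matrix[OF q] by (simp add: Q_def[symmetric])
qed

lemma lorentzian_polar_pos:
  assumes "f \<in> lorentzian_forms d K" "f \<noteq> (\<lambda>_. 0)" "2 \<le> d" "length as = d" "set as \<subseteq> interior K"
  shows "0 < polar f as"
proof -
  obtain x y bs where as: "as = x # y # bs" "length bs + 2 = d"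
    using assms(3,4) by (metis One_nat_def Suc_1 Suc_le_length_iff add_2_eq_Suc' length_Cons)
  then have "set bs \<subseteq> interior K" using assms by auto
  from lorentzian_matrix[OF assms(1-3) as(2) this] show ?thesis
    using assms(5) as by (metis list.set_intros(1) list.set_intros(2) subsetD)
qed

lemma shift_list: "set as \<subseteq> K \<Longrightarrow> 0 < t \<Longrightarrow> set (map (\<lambda>a. a + t *\<^sub>R w) as) \<subseteq> interior K"
  using interior_shift by auto

text \<open>
  Boundary tuples are limits of the interior tuples obtained by adding \<open>t w\<close> to each entry.
\<close>

lemma lorentzian_polar_nonneg:
  assumes f: "f \<in> lorentzian_forms d K" and d: "2 \<le> d" and as: "length as = d" "set as \<subseteq> K"
  shows "0 \<le> polar f as"
proof (cases "f = (\<lambda>_. 0)")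
  case False
  have "0 \<le> polar f (map (\<lambda>a. a + 0 *\<^sub>R w) as)"
    by (rule nonneg_at_zero[OF continuous_polar_shift], rule less_imp_le,
        rule lorentzian_polar_pos[OF f False d _ shift_list[OF as(2)]]) (simp_all add: as)
  then show ?thesis by simp
qed (simp add: polar_def dir_derivs_zero)

text \<open>
  The entries of \<open>as\<close> and the vector \<open>u\<close> are pushed into the interior by \<open>t w\<close>, with \<open>t \<rightarrow> 0\<close>, while
  \<open>x\<close> stays fixed; for this \<open>x\<close> is absorbed into the form as \<open>D\<^sub>x f\<close> and \<open>D\<^sub>x (D\<^sub>x f)\<close>.
\<close>

lemma lorentzian_reversed_cauchy_schwarz:
  assumes f: "f \<in> lorentzian_forms d K" and d: "2 \<le> d" and as: "length as + 2 = d" "set as \<subseteq> K"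
    and u: "u \<in> K"
  shows "polar f (u # u # as) * polar f (x # x # as) \<le> (polar f (u # x # as))\<^sup>2"
proof (cases "f = (\<lambda>_. 0)")
  case False
  define M where "M bs t = map (\<lambda>a. a + t *\<^sub>R w) bs" for bs t
  define g where "g t = (polar (dir_deriv x f) (M (u # as) t))\<^sup>2
      - polar f (M (u # u # as) t) * polar (dir_deriv x (dir_deriv x f)) (M as t)" for t
  have "0 \<le> g 0"
  proof (rule nonneg_at_zero)
    show "continuous_on UNIV g"
      unfolding g_def M_def by (intro continuous_intros continuous_polar_shift)
    fix t :: real assume t: "0 < t"
    have len: "length (M as t) + 2 = d" using as by (simp add: M_def)
    have sh: "set (M as t) \<subseteq> interior K" "u + t *\<^sub>R w \<in> interior K"
      using shift_list[OF as(2) t] interior_shift[OF u t] by (simp_all add: M_def)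
    obtain Q where Q: "transpose Q = Q"
        and m: "\<And>x y. x \<bullet> (Q *v y) = polar f (x # y # M as t) / 2"
        and one: "num_pos_eigenvalues Q = 1"
        and p: "\<And>x y. x \<in> interior K \<Longrightarrow> y \<in> interior K \<Longrightarrow> 0 < polar f (x # y # M as t)"
      using lorentzian_matrix[OF f False d len sh(1)] by blast
    let ?u = "u + t *\<^sub>R w"
    have "0 < ?u \<bullet> (Q *v ?u)" using p[OF sh(2) sh(2)] by (simp add: m)
    from reversed_cauchy_schwarz_if_one_positive_eigenvalue[OF Q one this, of x]
    have "polar f (?u # ?u # M as t) * polar f (x # x # M as t) \<le> (polar f (?u # x # M as t))\<^sup>2"
      by (simp add: m power_divide)
    then show "0 \<le> g t"
      using polar_swap[of f ?u x] by (simp add: g_def polar_dir_deriv) (simp add: M_def)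
  qed
  then show ?thesis using polar_swap[of f u x] by (simp add: g_def polar_dir_deriv M_def)
qed (simp add: polar_def dir_derivs_zero)

lemma lorentzian_scale:
  assumes "f \<in> lorentzian_forms d K" "2 \<le> d" "0 \<le> c"
  shows "(\<lambda>\<alpha>. c * f \<alpha>) \<in> lorentzian_forms d K"
proof (rule lorentzianI)
  show "(\<lambda>\<alpha>. c * f \<alpha>) \<in> forms d" using assms(1) by (auto simp: lorentzian_forms_def forms_def)
next
  fix as x assume "length as + 2 = d" "set as \<subseteq> interior K"
  then have "polar f (w # w # as) * polar f (x # x # as) \<le> (polar f (w # x # as))\<^sup>2"
    using assms w_cone interior_subset by (intro lorentzian_reversed_cauchy_schwarz) auto
  from mult_left_mono[OF this, of "c\<^sup>2"]
  show "polar (\<lambda>\<alpha>. c * f \<alpha>) (w # w # as) * polar (\<lambda>\<alpha>. c * f \<alpha>) (x # x # as)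
      \<le> (polar (\<lambda>\<alpha>. c * f \<alpha>) (w # x # as))\<^sup>2"
    by (simp add: polar_scale power_mult_distrib power2_eq_square mult_ac)
qed (use assms interior_subset in \<open>auto simp: polar_scale intro!: mult_nonneg_nonneg lorentzian_polar_nonneg\<close>)

lemma divided_power_lorentzian:
  assumes "2 \<le> d" "\<And>a. a \<in> K - {0} \<Longrightarrow> 0 < l \<bullet> a"
  shows "divided_power l d \<in> lorentzian_forms d K"
proof (rule lorentzianI[OF divided_power_forms assms(1)])
  fix as :: "(real^'n) list" assume as: "length as = d" "set as \<subseteq> interior K"
  then have "0 \<le> (\<Prod>a\<leftarrow>as. l \<bullet> a)"
    using assms(2) interior_nonzero by (intro prod_list_nonneg) (auto intro!: less_imp_le)
  then show "0 \<le> polar (divided_power l d) as" using as by (simp add: polar_divided_power)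
qed (simp add: polar_divided_power power2_eq_square mult_ac)

lemma closed_lorentzian_forms:
  assumes d: "2 \<le> d" shows "closed (lorentzian_forms d K)"
proof -
  let ?N = "\<Inter>as\<in>{as. length as = d \<and> set as \<subseteq> interior K}. {f. 0 \<le> polar f as}"
  let ?R = "\<Inter>as\<in>{as. length as + 2 = d \<and> set as \<subseteq> interior K}. \<Inter>x.
    {f. polar f (w # w # as) * polar f (x # x # as) \<le> (polar f (w # x # as))\<^sup>2}"
  have "lorentzian_forms d K = forms d \<inter> ?N \<inter> ?R"
  proof (intro subset_antisym subsetI)
    fix f assume f: "f \<in> lorentzian_forms d K"
    have "0 \<le> polar f as" if "length as = d" "set as \<subseteq> interior K" for as
      using lorentzian_polar_nonneg[OF f d that(1)] that(2) interior_subset by blast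
    moreover have "polar f (w # w # as) * polar f (x # x # as) \<le> (polar f (w # x # as))\<^sup>2"
      if "length as + 2 = d" "set as \<subseteq> interior K" for as x
      using lorentzian_reversed_cauchy_schwarz[OF f d that(1) _ w_cone(1)] that(2) interior_subset by blast
    ultimately show "f \<in> forms d \<inter> ?N \<inter> ?R" using lorentzian_in_forms[OF f] by blast
  next
    fix f assume "f \<in> forms d \<inter> ?N \<inter> ?R"
    then show "f \<in> lorentzian_forms d K" by (intro lorentzianI[OF _ d]) blast+
  qed
  moreover have "closed (forms d :: 'n polyn set)"
  proof -
    have "forms d = (\<Inter>\<alpha>\<in>{\<alpha>. sum \<alpha> UNIV \<noteq> d}. {f :: 'n polyn. f \<alpha> = 0})"
      by (auto simp: forms_def)
    then show ?thesis
      by (auto intro!: closed_Collect_eq continuous_coefficient)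
  qed
  ultimately show ?thesis
    by (auto intro!: closed_Collect_le continuous_intros continuous_polar)
qed

section \<open>Openness of the set of strictly Lorentzian forms\<close>

text \<open>
  Expressed through the polarisation, with nonsingularity as a trivial kernel, strictness can be
  passed to directional derivatives.
\<close>

lemma strictly_lorentzian_iff:
  assumes d: "2 \<le> d"
  shows "f \<in> strictly_lorentzian_forms d K \<longleftrightarrow> f \<in> lorentzian_forms d K
    \<and> (\<forall>as. length as = d \<and> set as \<subseteq> K - {0} \<longrightarrow> 0 < polar f as)
    \<and> (\<forall>as z. length as + 2 = d \<and> set as \<subseteq> K - {0} \<and> (\<forall>y. polar f (y # z # as) = 0) \<longrightarrow> z = 0)"
    (is "?L \<longleftrightarrow> ?R")
proof (cases "f \<in> forms d")
  case f: True
  define Q where "Q as = quad_matrix (dir_derivs as f)" for as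
  have m: "x \<bullet> (Q as *v y) = polar f (x # y # as) / 2" if "length as + 2 = d" for x y as
    by (simp add: Q_def quad_matrix_polar[OF dir_derivs_in_forms_2[OF d that f]] polar_dir_derivs)
  have inv: "invertible (Q as) \<longleftrightarrow> (\<forall>z. (\<forall>y. polar f (y # z # as) = 0) \<longrightarrow> z = 0)"
    if "length as + 2 = d" for as
  proof -
    have "Q as *v z = 0 \<longleftrightarrow> (\<forall>y. polar f (y # z # as) = 0)" for z
      using m[OF that, of _ z] vector_eq_rdot[of "Q as *v z" 0]
      by (auto simp: inner_commute)
    then show ?thesis by (simp add: invertible_left_inverse matrix_left_invertible_ker)
  qed
  have len: "length as = d - 2 \<longleftrightarrow> length as + 2 = d" for as :: "(real^'n) list" using d by auto
  have split: "(\<forall>as. length as = d \<and> set as \<subseteq> K - {0} \<longrightarrow> 0 < polar f as) \<longleftrightarrow>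
    (\<forall>as. length as + 2 = d \<and> set as \<subseteq> K - {0}
      \<longrightarrow> (\<forall>x\<in>K - {0}. \<forall>y\<in>K - {0}. 0 < polar f (x # y # as)))" (is "?A \<longleftrightarrow> ?B")
  proof
    assume ?A then show ?B by auto
  next
    assume B: ?B
    show ?A
    proof (intro allI impI, elim conjE)
      fix as assume as: "length as = d" "set as \<subseteq> K - {0}"
      obtain x y bs where "as = x # y # bs"
        using as(1) d by (metis One_nat_def Suc_1 Suc_le_length_iff)
      then show "0 < polar f as" using B as by auto
    qed
  qed
  have "?L \<longleftrightarrow> f \<in> lorentzian_forms d K \<and> (\<forall>as. length as + 2 = d \<and> set as \<subseteq> K - {0} \<longrightarrow>
      invertible (Q as) \<and> (\<forall>x\<in>K - {0}. \<forall>y\<in>K - {0}. 0 < x \<bullet> (Q as *v y)))"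
    unfolding strictly_lorentzian_forms_def Let_def Q_def mem_Collect_eq len by (rule refl)
  also have "\<dots> \<longleftrightarrow> f \<in> lorentzian_forms d K \<and> (\<forall>as. length as + 2 = d \<and> set as \<subseteq> K - {0} \<longrightarrow>
      (\<forall>z. (\<forall>y. polar f (y # z # as) = 0) \<longrightarrow> z = 0) \<and>
      (\<forall>x\<in>K - {0}. \<forall>y\<in>K - {0}. 0 < polar f (x # y # as)))"
    by (simp add: inv m cong: conj_cong imp_cong)
  also have "\<dots> \<longleftrightarrow> ?R" unfolding split by blast
  finally show ?thesis .
next
  case False
  then show ?thesis by (simp add: strictly_lorentzian_forms_def lorentzian_forms_def)
qed


lemma strictly_lorentzian_scale:
  assumes "f \<in> strictly_lorentzian_forms d K" "2 \<le> d" "0 < c"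
  shows "(\<lambda>\<alpha>. c * f \<alpha>) \<in> strictly_lorentzian_forms d K"
  using assms lorentzian_scale[of f d c]
  by (simp add: strictly_lorentzian_iff polar_scale)

text \<open>
  This equivalence trades one of the arguments \<open>a\<^sub>i\<close> for a derivative, which lets the openness proof
  run by induction with compactness applied to a single vector at a time.
\<close>

lemma strictly_lorentzian_Suc_iff:
  assumes d: "2 \<le> d"
  shows "f \<in> strictly_lorentzian_forms (Suc d) K \<longleftrightarrow>
    f \<in> forms (Suc d) \<and> (\<forall>a\<in>K - {0}. dir_deriv a f \<in> strictly_lorentzian_forms d K)"
proof (intro iffI conjI ballI)
  have d': "2 \<le> Suc d" using d by simp
  have perm: "polar (dir_deriv a f) (x # y # as) = polar f (x # y # a # as)" for a x y as f
    unfolding polar_dir_deriv by (rule polar_permute) simp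
  {
    assume f: "f \<in> strictly_lorentzian_forms (Suc d) K"
    note f' = f[unfolded strictly_lorentzian_iff[OF d']]
    then show forms: "f \<in> forms (Suc d)" using lorentzian_in_forms by blast
    fix a assume a: "a \<in> K - {0}"
    have "dir_deriv a f \<in> lorentzian_forms d K"
    proof (rule lorentzianI[OF dir_deriv_forms[OF forms] d])
      fix as assume "length as = d" "set as \<subseteq> interior K"
      then show "0 \<le> polar (dir_deriv a f) as"
        unfolding polar_dir_deriv using f' a interior_subset
        by (intro lorentzian_polar_nonneg[OF _ d']) auto
    next
      fix as x assume "length as + 2 = d" "set as \<subseteq> interior K"
      then show "polar (dir_deriv a f) (w # w # as) * polar (dir_deriv a f) (x # x # as)
          \<le> (polar (dir_deriv a f) (w # x # as))\<^sup>2"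
        unfolding perm using f' a interior_subset w_cone
        by (intro lorentzian_reversed_cauchy_schwarz[OF _ d']) auto
    qed
    moreover have "0 < polar (dir_deriv a f) as" if "length as = d" "set as \<subseteq> K - {0}" for as
      unfolding polar_dir_deriv using f' a that by auto
    moreover have "z = 0" if "length as + 2 = d" "set as \<subseteq> K - {0}"
      and "\<And>y. polar (dir_deriv a f) (y # z # as) = 0" for as z
    proof -
      have "length (a # as) + 2 = Suc d" "set (a # as) \<subseteq> K - {0}" using that a by auto
      with f' that(3)[unfolded perm] show ?thesis by blast
    qed
    ultimately show "dir_deriv a f \<in> strictly_lorentzian_forms d K"
      unfolding strictly_lorentzian_iff[OF d] by blast
  }
  assume h: "f \<in> forms (Suc d) \<and> (\<forall>a\<in>K - {0}. dir_deriv a f \<in> strictly_lorentzian_forms d K)"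
  then have forms: "f \<in> forms (Suc d)" by blast
  have h: "dir_deriv a f \<in> strictly_lorentzian_forms d K" if "a \<in> K - {0}" for a
    using h that by blast
  note h' = h[unfolded strictly_lorentzian_iff[OF d]]
  have "f \<in> lorentzian_forms (Suc d) K"
  proof (rule lorentzianI[OF forms d'])
    fix as assume as: "length as = Suc d" "set as \<subseteq> interior K"
    then obtain a bs where c: "as = a # bs" by (cases as) auto
    then have "a \<in> K - {0}" "set bs \<subseteq> K" "length bs = d" using as interior_nonzero interior_subset by auto
    then show "0 \<le> polar f as"
      using lorentzian_polar_nonneg[OF _ d, of "dir_deriv a f" bs] h' c by (simp add: polar_dir_deriv)
  next
    fix as x assume as: "length as + 2 = Suc d" "set as \<subseteq> interior K"
    then obtain a bs where c: "as = a # bs" using d by (cases as) auto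
    then have "a \<in> K - {0}" "set bs \<subseteq> K" "length bs + 2 = d"
      using as interior_nonzero interior_subset by auto
    then show "polar f (w # w # as) * polar f (x # x # as) \<le> (polar f (w # x # as))\<^sup>2"
      using lorentzian_reversed_cauchy_schwarz[OF _ d, of "dir_deriv a f" bs w x] h' c w_cone
      by (simp add: perm)
  qed
  moreover have "0 < polar f as" if as: "length as = Suc d" "set as \<subseteq> K - {0}" for as
  proof -
    obtain a bs where c: "as = a # bs" using as by (cases as) auto
    then show ?thesis using h'[of a] as by (auto simp: polar_dir_deriv)
  qed
  moreover have "z = 0" if as: "length as + 2 = Suc d" "set as \<subseteq> K - {0}"
    and z: "\<And>y. polar f (y # z # as) = 0" for as z
  proof -
    obtain a bs where c: "as = a # bs" using as d by (cases as) auto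
    then have "a \<in> K - {0}" "set bs \<subseteq> K - {0}" "length bs + 2 = d" using as by auto
    with h'[OF this(1)] z[unfolded c, folded perm] show ?thesis by blast
  qed
  ultimately show "f \<in> strictly_lorentzian_forms (Suc d) K"
    unfolding strictly_lorentzian_iff[OF d'] by blast
qed

lemma unit_vector_cone:
  assumes "a \<in> K - {0}" obtains b where "b \<in> K \<inter> sphere 0 1" "a = norm a *\<^sub>R b" "0 < norm a"
  using that[of "(1 / norm a) *\<^sub>R a"] assms cone_scale[of a "1 / norm a"] by simp

text \<open>
  The discriminant \<open>B(w, x)\<^sup>2 - B(w, w) B(x, x)\<close> is unchanged when a multiple of \<open>w\<close> is added to
  \<open>x\<close> and is homogeneous, so it is determined by its values on unit vectors orthogonal to \<open>w\<close>.
  Reversed Cauchy--Schwarz says that it is nonnegative; when moreover \<open>B(w, w) > 0\<close>, it is positive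
  on those unit vectors precisely if \<open>B\<close> has trivial kernel. The right-hand side is positivity on compact sets, an open condition on \<open>f\<close>.
\<close>

lemma strictly_lorentzian_2_iff:
  "f \<in> strictly_lorentzian_forms 2 K \<longleftrightarrow> f \<in> forms 2
    \<and> (\<forall>p\<in>(K \<inter> sphere 0 1) \<times> (K \<inter> sphere 0 1). 0 < polar f [fst p, snd p])
    \<and> (\<forall>x\<in>sphere 0 1 \<inter> {x. w \<bullet> x = 0}. polar f [w, w] * polar f [x, x] < (polar f [w, x])\<^sup>2)"
    (is "?L \<longleftrightarrow> ?F \<and> ?P \<and> ?D")
proof (intro iffI conjI)
  note B = bilinear_polar[of f "[]"]
  note bl = bilinear_ladd[OF B] bilinear_radd[OF B] bilinear_lmul[OF B] bilinear_rmul[OF B]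
    bilinear_lsub[OF B] bilinear_rsub[OF B]
  note sym = polar_swap[of f _ _ "[]"]
  have ww: "0 < w \<bullet> w" using w_cone by simp
  {
    assume L: ?L
    note L' = L[unfolded strictly_lorentzian_iff[OF order_refl]]
    have pos: "0 < polar f [x, y]" if "x \<in> K - {0}" "y \<in> K - {0}" for x y
      using L' that by auto
    have ker: "z = 0" if "\<And>y. polar f [y, z] = 0" for z
      using L' that by (metis (mono_tags, lifting) add_0 empty_subsetI list.set(1) list.size(3))
    have rcs: "polar f [w, w] * polar f [x, x] \<le> (polar f [w, x])\<^sup>2" for x
      using lorentzian_reversed_cauchy_schwarz[of f 2 "[]" w x] L' w_cone by simp
    show ?F using L' lorentzian_in_forms by blast
    have "x \<noteq> 0" if "norm x = 1" for x :: "real ^ 'n" using that by auto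
    then show ?P by (auto intro!: pos)
    show ?D
    proof
      fix x assume x: "x \<in> sphere 0 1 \<inter> {x. w \<bullet> x = 0}"
      have pw: "0 < polar f [w, w]" using pos w_cone by blast
      have "polar f [w, w] * polar f [x, x] \<noteq> (polar f [w, x])\<^sup>2"
      proof
        assume e: "polar f [w, w] * polar f [x, x] = (polar f [w, x])\<^sup>2"
        define t where "t = polar f [w, x] / polar f [w, w]"
        define z where "z = x - t *\<^sub>R w"
        have t: "polar f [w, x] = t * polar f [w, w]" using pw by (simp add: t_def)
        have xx: "polar f [x, x] = t\<^sup>2 * polar f [w, w]"
          using e pw unfolding t by (simp add: power2_eq_square)
        have "polar f [w, z] = 0" "polar f [z, z] = 0"
          using sym[of x w] by (simp_all add: z_def bl t xx power2_eq_square)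
        then have "polar f [z, y] = 0" for y
          by (rule isotropic_in_kernel[OF B sym pw rcs])
        then have "z = 0" using ker sym by metis
        then have "w \<bullet> x = t * (w \<bullet> w)" by (simp add: z_def)
        then have "t = 0" using x ww by simp
        then show False using \<open>z = 0\<close> x by (simp add: z_def)
      qed
      then show "polar f [w, w] * polar f [x, x] < (polar f [w, x])\<^sup>2" using rcs[of x] by simp
    qed
  }
  assume R: "?F \<and> ?P \<and> ?D"
  have pos: "0 < polar f [x, y]" if xy: "x \<in> K - {0}" "y \<in> K - {0}" for x y
  proof -
    obtain x' where x': "x' \<in> K \<inter> sphere 0 1" "x = norm x *\<^sub>R x'" "0 < norm x"
      using unit_vector_cone[OF xy(1)] by blast
    obtain y' where y': "y' \<in> K \<inter> sphere 0 1" "y = norm y *\<^sub>R y'" "0 < norm y"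
      using unit_vector_cone[OF xy(2)] by blast
    have "0 < polar f [x', y']" using R x' y' by auto
    then have "0 < polar f [norm x *\<^sub>R x', norm y *\<^sub>R y']" using x'(3) y'(3) by (simp add: bl)
    then show ?thesis using x'(2) y'(2) by simp
  qed
  have pw: "0 < polar f [w, w]" using pos w_cone by blast
  define disc where "disc x = (polar f [w, x])\<^sup>2 - polar f [w, w] * polar f [x, x]" for x
  have shift: "disc (x + t *\<^sub>R w) = disc x" for x t
    using sym[of x w] by (simp add: disc_def bl power2_eq_square algebra_simps)
  have dscale: "disc (r *\<^sub>R x) = r\<^sup>2 * disc x" for x r
    by (simp add: disc_def bl power2_eq_square algebra_simps)
  \<comment> \<open>the projection onto the orthogonal complement of \<open>w\<close>, along \<open>w\<close>\<close>
  define p where "p x = x - ((w \<bullet> x) / (w \<bullet> w)) *\<^sub>R w" for x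
  have dp: "disc (p x) = disc x" for x
    using shift[of "p x" "(w \<bullet> x) / (w \<bullet> w)"] by (simp add: p_def)
  have dpos: "0 < disc x" if "p x \<noteq> 0" for x
  proof -
    have "w \<bullet> p x = 0" using ww by (simp add: p_def inner_diff_right)
    then have "(1 / norm (p x)) *\<^sub>R p x \<in> sphere 0 1 \<inter> {x. w \<bullet> x = 0}" using that by simp
    with R have "0 < disc ((1 / norm (p x)) *\<^sub>R p x)" unfolding disc_def by fastforce
    then show ?thesis using that unfolding dscale dp by (simp add: zero_less_mult_iff)
  qed
  have dzero: "disc x = 0" if "p x = 0" for x
    using dp[of x] that dscale[of 0 0] by simp
  have "f \<in> lorentzian_forms 2 K"
  proof (rule lorentzianI)
    fix as assume as: "length as = 2" "set as \<subseteq> interior K"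
    then obtain x y where c: "as = [x, y]" by (auto simp: numeral_2_eq_2 length_Suc_conv)
    then have "x \<in> K - {0}" "y \<in> K - {0}" using as interior_nonzero by auto
    then show "0 \<le> polar f as" unfolding c by (rule less_imp_le[OF pos])
  next
    fix as x assume "length as + 2 = 2" "set as \<subseteq> interior K"
    then show "polar f (w # w # as) * polar f (x # x # as) \<le> (polar f (w # x # as))\<^sup>2"
      using dpos[of x] dzero[of x] by (cases "p x = 0") (simp_all add: disc_def)
  qed (use R in auto)
  moreover have "0 < polar f as" if as: "length as = 2" "set as \<subseteq> K - {0}" for as
  proof -
    obtain x y where "as = [x, y]" using as by (auto simp: numeral_2_eq_2 length_Suc_conv)
    then show ?thesis using pos[of x y] as by auto
  qed
  moreover have "z = 0" if "length as + 2 = 2" "\<And>y. polar f (y # z # as) = 0" for as z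
  proof -
    have z: "polar f [y, z] = 0" for y using that by simp
    then have "disc z = 0" by (simp add: disc_def)
    then have "p z = 0" using dpos[of z] by force
    then have e: "z = ((w \<bullet> z) / (w \<bullet> w)) *\<^sub>R w" by (simp add: p_def)
    have "polar f [w, z] = ((w \<bullet> z) / (w \<bullet> w)) * polar f [w, w]"
      by (subst e) (simp add: bl)
    then have "(w \<bullet> z) / (w \<bullet> w) = 0" using z[of w] pw by simp
    then show ?thesis by (subst e) (simp only: scaleR_zero_left)
  qed
  ultimately show ?L unfolding strictly_lorentzian_iff[OF order_refl] by blast
qed

lemma strictly_lorentzian_open:
  assumes "2 \<le> d"
  shows "\<exists>U. open U \<and> strictly_lorentzian_forms d K = U \<inter> forms d"
  using assms
proof (induction d rule: nat_induct_at_least)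
  case base
  let ?C = "K \<inter> sphere 0 1" and ?S = "sphere 0 1 \<inter> {x. w \<bullet> x = 0}"
  define U where "U = {f :: 'n polyn. \<forall>p\<in>?C \<times> ?C. (f, p) \<in> {q. 0 < polar (fst q) [fst (snd q), snd (snd q)]}}"
  define V where "V = {f :: 'n polyn. \<forall>x\<in>?S. (f, x) \<in> {q. polar (fst q) [w, w] * polar (fst q) [snd q, snd q]
      < (polar (fst q) [w, snd q])\<^sup>2}}"
  have co: "continuous_on UNIV (\<lambda>q :: 'n polyn \<times> 'b::topological_space. fst q \<alpha>)" for \<alpha>
    by (rule continuous_on_product_then_coordinatewise[OF continuous_on_fst[OF continuous_on_id]])
  have "compact ?C" using proper by (simp add: proper_convex_cone_def closed_Int_compact)
  then have "open U" unfolding U_def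
    by (intro open_forall_compact compact_Times open_Collect_less continuous_intros
        continuous_polar_intro co)
  moreover have "compact ?S" by (intro compact_Int_closed compact_sphere closed_hyperplane)
  then have "open V" unfolding V_def
    by (intro open_forall_compact open_Collect_less continuous_intros continuous_polar_intro co)
  moreover have "strictly_lorentzian_forms 2 K = (U \<inter> V) \<inter> forms 2"
    by (rule set_eqI) (auto simp: strictly_lorentzian_2_iff U_def V_def)
  ultimately show ?case by blast
next
  case (Suc d)
  then obtain U where U: "open U" "strictly_lorentzian_forms d K = U \<inter> forms d" by blast
  let ?C = "K \<inter> sphere 0 1"
  define V where "V = {f. \<forall>a\<in>?C. (f, a) \<in> (\<lambda>q. dir_deriv (snd q) (fst q)) -` U}"
  have C: "compact ?C" using proper by (simp add: proper_convex_cone_def closed_Int_compact)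
  have cont: "continuous_on UNIV (\<lambda>q :: 'n polyn \<times> (real^'n). dir_deriv (snd q) (fst q))"
    by (intro continuous_on_coordinatewise_then_product continuous_dir_deriv continuous_intros
        continuous_on_product_then_coordinatewise[OF continuous_on_fst[OF continuous_on_id]])
  have "open V"
    unfolding V_def by (rule open_forall_compact[OF C open_vimage[OF U(1) cont]])
  moreover have "strictly_lorentzian_forms (Suc d) K = V \<inter> forms (Suc d)"
  proof (intro set_eqI iffI)
    fix f assume "f \<in> strictly_lorentzian_forms (Suc d) K"
    then show "f \<in> V \<inter> forms (Suc d)"
      using U(2) by (auto simp: strictly_lorentzian_Suc_iff[OF Suc(1)] V_def)
  next
    fix f assume f: "f \<in> V \<inter> forms (Suc d)"
    have "dir_deriv a f \<in> strictly_lorentzian_forms d K" if "a \<in> K - {0}" for a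
    proof -
      obtain b where b: "b \<in> ?C" "a = norm a *\<^sub>R b" "0 < norm a"
        using unit_vector_cone[OF \<open>a \<in> K - {0}\<close>] by blast
      have "dir_deriv b f \<in> strictly_lorentzian_forms d K"
        using f b(1) U(2) dir_deriv_forms by (auto simp: V_def)
      from strictly_lorentzian_scale[OF this Suc(1) b(3)] b(2)
      show ?thesis by (metis dir_deriv_scaleR_vec ext)
    qed
    then show "f \<in> strictly_lorentzian_forms (Suc d) K"
      using f by (simp add: strictly_lorentzian_Suc_iff[OF Suc(1)])
  qed
  ultimately show ?case by blast
qed

section \<open>Interior points are strictly Lorentzian\<close>

lemma perturbation_lorentzian:
  assumes U: "open U" "f \<in> U" "U \<inter> forms d \<subseteq> lorentzian_forms d K"
    and f: "f \<in> forms d" and g: "g \<in> forms d"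
  obtains r where "0 < r" "\<And>t. \<bar>t\<bar> \<le> r \<Longrightarrow> (\<lambda>\<alpha>. f \<alpha> + t * g \<alpha>) \<in> lorentzian_forms d K"
proof -
  let ?F = "\<lambda>t \<alpha>. f \<alpha> + t * g \<alpha>"
  have "continuous_on UNIV ?F"
    by (intro continuous_on_coordinatewise_then_product continuous_intros)
  then have "open (?F -` U)" using U(1) by (simp add: open_vimage)
  moreover have "0 \<in> ?F -` U" using U(2) by simp
  ultimately obtain r where r: "0 < r" "cball 0 r \<subseteq> ?F -` U"
    using open_contains_cball by blast
  have "?F t \<in> lorentzian_forms d K" if "\<bar>t\<bar> \<le> r" for t
  proof -
    have "?F t \<in> U" using r that by (auto simp: subset_iff)
    moreover have "?F t \<in> forms d" using f g by (auto simp: forms_def) (metis add_0 mult_zero_right)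
    ultimately show ?thesis using U(3) by blast
  qed
  then show ?thesis using that r(1) by blast
qed

text \<open>
  Let \<open>g = l\<^sup>d / d!\<close>, whose polarisation is the product of the \<open>l \<bullet> a\<^sub>i\<close>. Positivity for \<open>f\<close> follows
  from nonnegativity for \<open>f - r g\<close>. For a kernel vector \<open>z\<close> of \<open>f\<close> with \<open>l \<bullet> z \<noteq> 0\<close>, reversed
  Cauchy--Schwarz for \<open>f + r g\<close> at \<open>w\<close> and \<open>z\<close> reads \<open>T(w, w) r c (l \<bullet> z)\<^sup>2 \<le> 0\<close> after the terms of
  order \<open>r\<^sup>2\<close> cancel, which contradicts \<open>T(w, w) > 0\<close>. As the available \<open>l\<close> span the dual space,
  \<open>z = 0\<close>.
\<close>

lemma interior_point_strictly_lorentzian: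
  assumes d: "2 \<le> d" and U: "open U" "f \<in> U" "U \<inter> forms d \<subseteq> lorentzian_forms d K"
    and f: "f \<in> forms d"
  shows "f \<in> strictly_lorentzian_forms d K"
proof -
  obtain L where L: "\<And>l a. l \<in> set L \<Longrightarrow> a \<in> K - {0} \<Longrightarrow> 0 < l \<bullet> a"
      "\<And>z. (\<And>l. l \<in> set L \<Longrightarrow> l \<bullet> z = 0) \<Longrightarrow> z = 0" and ne: "L \<noteq> []"
    using separating_functionals[OF proper] by metis
  note pert = perturbation_lorentzian[OF U f divided_power_forms]
  have prod_pos: "0 < (\<Prod>a\<leftarrow>as. l \<bullet> a)" if "l \<in> set L" "set as \<subseteq> K - {0}" for l as
    using that(2) L(1)[OF that(1)] by (induction as) auto
  have pos: "0 < polar f as" if as: "length as = d" "set as \<subseteq> K - {0}" for as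
  proof -
    define l where "l = hd L"
    have l: "l \<in> set L" using ne by (simp add: l_def)
    obtain r where r: "0 < r" "\<And>t. \<bar>t\<bar> \<le> r \<Longrightarrow> (\<lambda>\<alpha>. f \<alpha> + t * divided_power l d \<alpha>) \<in> lorentzian_forms d K"
      using pert by metis
    have "0 \<le> polar (\<lambda>\<alpha>. f \<alpha> + (- r) * divided_power l d \<alpha>) as"
      using as r by (intro lorentzian_polar_nonneg[OF r(2) d]) auto
    then have "r * (\<Prod>a\<leftarrow>as. l \<bullet> a) \<le> polar f as"
      by (simp add: polar_comb[of f "- r", simplified] polar_divided_power[OF as(1)])
    moreover have "0 < r * (\<Prod>a\<leftarrow>as. l \<bullet> a)" using r(1) prod_pos[OF l as(2)] by simp
    ultimately show ?thesis by linarith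
  qed
  moreover have "z = 0" if as: "length as + 2 = d" "set as \<subseteq> K - {0}"
    and z: "\<And>y. polar f (y # z # as) = 0" for as z
  proof (rule L(2), rule ccontr)
    fix l assume l: "l \<in> set L" and lz: "l \<bullet> z \<noteq> 0"
    obtain r where r: "0 < r" "\<And>t. \<bar>t\<bar> \<le> r \<Longrightarrow> (\<lambda>\<alpha>. f \<alpha> + t * divided_power l d \<alpha>) \<in> lorentzian_forms d K"
      using pert by metis
    define c where "c = (\<Prod>a\<leftarrow>as. l \<bullet> a)"
    have c: "0 < c" unfolding c_def by (rule prod_pos[OF l as(2)])
    have g: "polar (\<lambda>\<alpha>. f \<alpha> + r * divided_power l d \<alpha>) (x # y # as)
        = polar f (x # y # as) + r * ((l \<bullet> x) * (l \<bullet> y) * c)" for x y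
      using as(1) by (simp add: polar_comb polar_divided_power c_def)
    have ww: "0 < polar f (w # w # as)" using pos[of "w # w # as"] as w_cone by simp
    have "polar (\<lambda>\<alpha>. f \<alpha> + r * divided_power l d \<alpha>) (w # w # as)
        * polar (\<lambda>\<alpha>. f \<alpha> + r * divided_power l d \<alpha>) (z # z # as)
        \<le> (polar (\<lambda>\<alpha>. f \<alpha> + r * divided_power l d \<alpha>) (w # z # as))\<^sup>2"
      using r as w_cone by (intro lorentzian_reversed_cauchy_schwarz[OF r(2) d]) auto
    then have "polar f (w # w # as) * (r * c * (l \<bullet> z)\<^sup>2) \<le> 0"
      unfolding g z by (simp add: power2_eq_square algebra_simps)
    moreover have "0 < polar f (w # w # as) * (r * c * (l \<bullet> z)\<^sup>2)"
      using ww r(1) c lz by simp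
    ultimately show False by linarith
  qed
  moreover have "f \<in> lorentzian_forms d K" using U f by blast
  ultimately show ?thesis unfolding strictly_lorentzian_iff[OF d] by blast
qed


section \<open>Density of strictly Lorentzian forms\<close>

lemma polar_exchange:
  assumes "j < length as"
  shows "polar f (as ! j # x # as[j := w]) = polar f (w # x # as)"
  using assms by (intro polar_permute) (simp add: mset_update add_mset_commute)

lemma lorentzian_hyperplane:
  assumes f: "f \<in> lorentzian_forms d K" and d: "2 \<le> d" and as: "length as + 2 = d" "set as \<subseteq> K"
    and u: "u \<in> K" "0 < polar f (u # u # as)" and x: "polar f (u # x # as) = 0"
  shows "polar f (x # x # as) \<le> 0"
  using lorentzian_reversed_cauchy_schwarz[OF f d as u(1), of x] x u(2) by (simp add: mult_le_0_iff)

text \<open>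
  Replacing the entry \<open>a = as ! j\<close> by \<open>w\<close> gives a quadratic form \<open>B\<^sub>j\<close> with
  \<open>B\<^sub>j(a, x) = T(w, x, as)\<close>. Thus the hyperplane \<open>T(w, x, as) = 0\<close> is at the same time the orthogonal
  complement of \<open>w\<close> with respect to the original form and of \<open>as ! j\<close> with respect to \<open>B\<^sub>j\<close>, and
  all these forms are nonpositive on it.
\<close>

lemma common_hyperplane:
  assumes f: "f \<in> lorentzian_forms d K" and d: "2 \<le> d" and T: "T \<subseteq> K" "w \<in> T"
    and pos: "\<And>bs. length bs = d \<Longrightarrow> set bs \<subseteq> T \<Longrightarrow> 0 < polar f bs"
    and as: "length as + 2 = d" "set as \<subseteq> T" and x: "polar f (w # x # as) = 0"
  shows "polar f (x # x # as) \<le> 0"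
    and "j < length as \<Longrightarrow> polar f (x # x # as[j := w]) \<le> 0"
proof -
  show "polar f (x # x # as) \<le> 0"
    using as T pos[of "w # w # as"] by (intro lorentzian_hyperplane[OF f d _ _ _ _ x]) auto
  assume j: "j < length as"
  then have "as ! j \<in> T" using as(2) by auto
  moreover have "set (as[j := w]) \<subseteq> T" using as(2) T(2) set_update_subset_insert by fast
  ultimately show "polar f (x # x # as[j := w]) \<le> 0"
    using as T pos[of "as ! j # as ! j # as[j := w]"] x polar_exchange[OF j, of f x]
    by (intro lorentzian_hyperplane[OF f d, of "as[j := w]" "as ! j"]) auto
qed

lemma nuij_nonneg:
  assumes f: "f \<in> lorentzian_forms d K" and d: "2 \<le> d" and s: "0 \<le> s"
    and l: "\<And>a. a \<in> K - {0} \<Longrightarrow> 0 < l \<bullet> a" and as: "length as = d" "set as \<subseteq> K"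
  shows "polar f as \<le> polar (nuij w s l f) as"
proof -
  have "0 \<le> (l \<bullet> as ! i) * polar f (as[i := w])" if "i < d" for i
  proof (rule mult_nonneg_nonneg)
    have "as ! i \<in> K" using as that by auto
    then show "0 \<le> l \<bullet> as ! i" using l[of "as ! i"] by (cases "as ! i = 0") auto
    have "set (as[i := w]) \<subseteq> K" using as(2) w_cone(1) set_update_subset_insert by fast
    then show "0 \<le> polar f (as[i := w])" using as(1) by (intro lorentzian_polar_nonneg[OF f d]) auto
  qed
  then have "0 \<le> s * (\<Sum>i<d. (l \<bullet> as ! i) * polar f (as[i := w]))"
    by (intro mult_nonneg_nonneg[OF s] sum_nonneg) simp
  then show ?thesis by (simp add: polar_nuij[OF lorentzian_in_forms[OF f] as(1)])
qed

text \<open>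
  On the common hyperplane \<open>T(w, x, as) = 0\<close> the Leibniz terms containing \<open>l \<bullet> x\<close> vanish and the
  others are nonpositive, so the new quadratic form is nonpositive on a hyperplane.
\<close>

lemma nuij_lorentzian:
  assumes f: "f \<in> lorentzian_forms d K" and d: "2 \<le> d" and s: "0 \<le> s"
    and l: "\<And>a. a \<in> K - {0} \<Longrightarrow> 0 < l \<bullet> a"
  shows "nuij w s l f \<in> lorentzian_forms d K"
proof (cases "f = (\<lambda>_. 0)")
  case False
  note forms = lorentzian_in_forms[OF f]
  show ?thesis
  proof (rule lorentzianI[OF nuij_forms[OF forms] d])
    fix as assume as: "length as = d" "set as \<subseteq> interior K"
    then have "set as \<subseteq> K" using interior_subset by blast
    then show "0 \<le> polar (nuij w s l f) as"
      using nuij_nonneg[OF f d s l as(1)] lorentzian_polar_nonneg[OF f d as(1)] by force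
  next
    fix as x assume as: "length as + 2 = d" "set as \<subseteq> interior K"
    note pos = lorentzian_polar_pos[OF f False d]
    let ?B = "\<lambda>x y. polar (nuij w s l f) (x # y # as)"
    show "?B w w * ?B x x \<le> (?B w x)\<^sup>2"
    proof (rule reversed_cauchy_schwarz_from_hyperplane[OF bilinear_polar polar_swap])
      show "linear (\<lambda>x. polar f (w # x # as))"
        unfolding polar_swap[of f w] by (rule linear_polar)
      show "0 < ?B w w"
        using pos[of "w # w # as"] nuij_nonneg[OF f d s l, of "w # w # as"] as w_interior interior_subset
        by fastforce
    next
      fix x assume x: "polar f (w # x # as) = 0"
      note hyp = common_hyperplane[OF f d interior_subset w_interior pos as x]
      have "(l \<bullet> as ! j) * polar f (x # x # as[j := w]) \<le> 0" if "j < length as" for j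
      proof (rule mult_nonneg_nonpos)
        have "as ! j \<in> interior K" using that as(2) nth_mem by blast
        then have "as ! j \<in> K - {0}" using interior_nonzero by blast
        then show "0 \<le> l \<bullet> as ! j" by (rule less_imp_le[OF l])
      qed (rule hyp(2)[OF _ _ that])
      then have "s * (\<Sum>j<length as. (l \<bullet> as ! j) * polar f (x # x # as[j := w])) \<le> 0"
        by (intro mult_nonneg_nonpos[OF s] sum_nonpos) simp
      then show "?B x x \<le> 0"
        using hyp(1) x by (simp add: polar_nuij_pair[OF forms as(1)])
    qed
  qed (use d in simp)
qed (simp add: nuij_def lorentzian_forms_def forms_def)

text \<open>
  Positivity of the polarisation when at most \<open>k\<close> arguments lie on the boundary of \<open>K\<close>: for a
  nonzero Lorentzian form this holds with \<open>k = 0\<close>, and \<open>k = d\<close> is the positivity that strictness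
  demands.
\<close>

definition positive_near_interior :: "nat \<Rightarrow> nat \<Rightarrow> 'n polyn \<Rightarrow> bool" where
  "positive_near_interior d k f \<longleftrightarrow> (\<forall>as. length as = d \<and> set as \<subseteq> K - {0}
     \<and> card {i. i < d \<and> as ! i \<notin> interior K} \<le> k \<longrightarrow> 0 < polar f as)"

text \<open>
  Among the terms added by the operator is one in which a boundary argument has been replaced by
  the interior point \<open>w\<close>; it is positive by assumption, and the others are nonnegative.
\<close>

lemma positive_near_interior_nuij:
  assumes f: "f \<in> lorentzian_forms d K" and d: "2 \<le> d" and s: "0 < s"
    and l: "\<And>a. a \<in> K - {0} \<Longrightarrow> 0 < l \<bullet> a" and p: "positive_near_interior d k f"
  shows "positive_near_interior d (Suc k) (nuij w s l f)"
  unfolding positive_near_interior_def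
proof (intro allI impI, elim conjE)
  fix as assume as: "length as = d" "set as \<subseteq> K - {0}"
    and c: "card {i. i < d \<and> as ! i \<notin> interior K} \<le> Suc k"
  have asK: "set as \<subseteq> K" using as(2) by blast
  show "0 < polar (nuij w s l f) as"
  proof (cases "\<exists>i<d. as ! i \<notin> interior K")
    case False
    then have "{i. i < d \<and> as ! i \<notin> interior K} = {}" by blast
    then have "card {i. i < d \<and> as ! i \<notin> interior K} \<le> k" by (simp only: card.empty)
    then have "0 < polar f as" using p as unfolding positive_near_interior_def by blast
    then show ?thesis using nuij_nonneg[OF f d less_imp_le[OF s] l as(1) asK] by linarith
  next
    case True
    then obtain i where i: "i < d" "as ! i \<notin> interior K" by blast
    let ?t = "\<lambda>i. (l \<bullet> as ! i) * polar f (as[i := w])"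
    have upd: "set (as[j := w]) \<subseteq> K - {0}" for j
      using as(2) w_cone(2) set_update_subset_insert by fast
    have lpos: "0 < l \<bullet> as ! j" if "j < d" for j
      using as that by (intro l) (auto simp: subset_iff)
    have "{j. j < d \<and> as[i := w] ! j \<notin> interior K} = {j. j < d \<and> as ! j \<notin> interior K} - {i}"
      using as(1) w_interior i by (auto simp: nth_list_update split: if_splits)
    then have "card {j. j < d \<and> as[i := w] ! j \<notin> interior K} \<le> k"
      using c i by (simp add: card_Diff_singleton)
    then have "0 < polar f (as[i := w])"
      using p[unfolded positive_near_interior_def, rule_format, of "as[i := w]"] as(1) upd by simp
    then have "0 < ?t i" using lpos[OF i(1)] by simp
    moreover have "0 \<le> ?t j" if "j < d" for j
    proof (rule mult_nonneg_nonneg[OF less_imp_le[OF lpos[OF that]]])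
      have "set (as[j := w]) \<subseteq> K" using upd by blast
      then show "0 \<le> polar f (as[j := w])"
        using as(1) by (intro lorentzian_polar_nonneg[OF f d]) auto
    qed
    ultimately have "0 < (\<Sum>j<d. ?t j)"
      using i(1) by (intro sum_pos2[of "{..<d}" i]) auto
    then have "0 < s * (\<Sum>j<d. ?t j)" using s by simp
    then show ?thesis
      using lorentzian_polar_nonneg[OF f d as(1) asK]
      by (simp add: polar_nuij[OF lorentzian_in_forms[OF f] as(1)])
  qed
qed

lemma positive_near_interior_0:
  assumes "f \<in> lorentzian_forms d K" "f \<noteq> (\<lambda>_. 0)" "2 \<le> d"
  shows "positive_near_interior d 0 f"
  unfolding positive_near_interior_def
proof (intro allI impI, elim conjE)
  fix as assume as: "length as = d" "card {i. i < d \<and> as ! i \<notin> interior K} \<le> 0"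
  then have "set as \<subseteq> interior K" by (auto simp: in_set_conv_nth)
  then show "0 < polar f as" using lorentzian_polar_pos assms as(1) by blast
qed

lemma positive_near_interior_full:
  "positive_near_interior d d f \<longleftrightarrow> (\<forall>as. length as = d \<and> set as \<subseteq> K - {0} \<longrightarrow> 0 < polar f as)"
proof -
  have "card {i. i < d \<and> as ! i \<notin> interior K} \<le> d" for as
    using card_mono[of "{..<d}" "{i. i < d \<and> as ! i \<notin> interior K}"] by auto
  then show ?thesis by (simp add: positive_near_interior_def)
qed

lemma positive_near_interior_weaken:
  "positive_near_interior d (Suc k) f \<Longrightarrow> positive_near_interior d k f"
  by (auto simp: positive_near_interior_def)

text \<open>
  Split \<open>z = x + t w\<close> with \<open>T(w, x, as) = 0\<close>. For \<open>z\<close> in the kernel of the new form \<open>B'\<close>,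
  \<open>B'(x, x) = t\<^sup>2 B'(w, w)\<close>; the left side is nonpositive and \<open>B'(w, w) > 0\<close>, so \<open>t = 0\<close>. Now \<open>z\<close>
  lies on the common hyperplane and \<open>B'(z, z) = 0\<close> is a sum of nonpositive terms. Hence \<open>z\<close> is
  isotropic for the old form \<open>B\<close> and for all \<open>B\<^sub>j\<close>, hence in their kernels, and what is left of
  \<open>B'(w, z) = 0\<close> is \<open>s (l \<bullet> z) B(w, w) = 0\<close>.
\<close>

lemma nuij_kernel:
  assumes f: "f \<in> lorentzian_forms d K" and d: "2 \<le> d" and s: "0 < s"
    and l: "\<And>a. a \<in> K - {0} \<Longrightarrow> 0 < l \<bullet> a"
    and pos: "\<And>bs. length bs = d \<Longrightarrow> set bs \<subseteq> K - {0} \<Longrightarrow> 0 < polar f bs"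
    and as: "length as + 2 = d" "set as \<subseteq> K - {0}"
    and ker: "\<And>y. polar (nuij w s l f) (y # z # as) = 0"
  shows "l \<bullet> z = 0" and "polar f (y # z # as) = 0"
proof -
  note forms = lorentzian_in_forms[OF f]
  have asK: "set as \<subseteq> K" using as(2) by blast
  let ?B' = "\<lambda>x y. polar (nuij w s l f) (x # y # as)"
  let ?B = "\<lambda>x y. polar f (x # y # as)"
  let ?Bj = "\<lambda>j x y. polar f (x # y # as[j := w])"
  have B': "?B' x y = ?B x y + s * ((l \<bullet> x) * ?B w y + (l \<bullet> y) * ?B w x
      + (\<Sum>j<length as. (l \<bullet> as ! j) * ?Bj j x y))" for x y
    by (rule polar_nuij_pair[OF forms as(1)])
  have lpos: "0 < l \<bullet> as ! j" if "j < length as" for j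
    using that as(2) by (intro l) (auto simp: subset_iff)
  have neg: "?B x x \<le> 0" "\<And>j. j < length as \<Longrightarrow> ?Bj j x x \<le> 0" if "?B w x = 0" for x
    using common_hyperplane[OF f d Diff_subset w_cone(2) pos as that] by auto
  have neg_sum: "s * (\<Sum>j<length as. (l \<bullet> as ! j) * ?Bj j x x) \<le> 0" if "?B w x = 0" for x
    using s neg(2)[OF that] lpos
    by (intro mult_nonneg_nonpos sum_nonpos) (auto intro!: mult_nonneg_nonpos less_imp_le)
  have ww: "0 < ?B w w" using pos[of "w # w # as"] as w_cone by simp
  have ww': "0 < ?B' w w"
    using ww nuij_nonneg[OF f d less_imp_le[OF s] l, of "w # w # as"] as(1) asK w_cone(1) by fastforce
  note bl = bilinear_lsub[OF bilinear_polar] bilinear_rsub[OF bilinear_polar]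
    bilinear_lmul[OF bilinear_polar] bilinear_rmul[OF bilinear_polar]
  have hz: "?B w z = 0"
  proof -
    define t where "t = ?B w z / ?B w w"
    define x where "x = z - t *\<^sub>R w"
    have x0: "?B w x = 0" using ww by (simp add: x_def t_def bl)
    have "?B' x x = t\<^sup>2 * ?B' w w"
      using ker ker[of z] polar_swap[of "nuij w s l f" z w] by (simp add: x_def bl power2_eq_square)
    moreover have "?B' x x \<le> 0" using neg(1)[OF x0] neg_sum[OF x0] x0 by (simp add: B')
    ultimately have "t = 0" using ww' by (smt (verit) mult_pos_pos zero_less_power2)
    then show ?thesis using ww by (simp add: t_def)
  qed
  have zz: "?B z z + s * (\<Sum>j<length as. (l \<bullet> as ! j) * ?Bj j z z) = 0"
    using ker[of z] hz by (simp add: B')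
  have Bz: "?B z y = 0" for y
  proof (rule isotropic_in_kernel[OF bilinear_polar polar_swap ww _ hz])
    show "?B w w * ?B x x \<le> (?B w x)\<^sup>2" for x
      by (rule lorentzian_reversed_cauchy_schwarz[OF f d as(1) asK w_cone(1)])
    show "?B z z = 0" using zz neg(1)[OF hz] neg_sum[OF hz] by linarith
  qed
  have Bjz: "?Bj j z y = 0" if j: "j < length as" for j y
  proof -
    have aj: "as ! j \<in> K - {0}" using j as(2) nth_mem by blast
    have upd: "set (as[j := w]) \<subseteq> K - {0}" using as(2) w_cone(2) set_update_subset_insert by fast
    show ?thesis
    proof (rule isotropic_in_kernel[OF bilinear_polar polar_swap, where u = "as ! j"])
      show "0 < ?Bj j (as ! j) (as ! j)"
        using aj upd as(1) by (intro pos) auto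
      show "?Bj j (as ! j) (as ! j) * ?Bj j x x \<le> (?Bj j (as ! j) x)\<^sup>2" for x
        using aj upd as(1) by (intro lorentzian_reversed_cauchy_schwarz[OF f d]) auto
      show "?Bj j (as ! j) z = 0" using hz by (simp add: polar_exchange[OF j])
      have "s * (\<Sum>j<length as. (l \<bullet> as ! j) * ?Bj j z z) = 0"
        using zz neg(1)[OF hz] neg_sum[OF hz] by linarith
      then have "(\<Sum>j<length as. (l \<bullet> as ! j) * - ?Bj j z z) = 0"
        using s by (simp add: sum_negf)
      then have "(l \<bullet> as ! j) * - ?Bj j z z = 0"
        using sum_nonneg_eq_0_iff[of "{..<length as}" "\<lambda>j. (l \<bullet> as ! j) * - ?Bj j z z"] j lpos
          neg(2)[OF hz] by (simp add: mult_nonneg_nonpos less_imp_le)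
      then show "?Bj j z z = 0" using lpos[OF j] by simp
    qed
  qed
  show "polar f (y # z # as) = 0" using Bz[of y] polar_swap[of f y z] by simp
  have "?B' w z = s * ((l \<bullet> z) * ?B w w)"
    using hz polar_swap[of f w z] Bjz by (simp add: B')
  then show "l \<bullet> z = 0" using ker[of w] s ww by simp
qed

lemma iterated_nuij_positive:
  assumes f: "f \<in> lorentzian_forms d K" "f \<noteq> (\<lambda>_. 0)" and d: "2 \<le> d" and s: "0 < s"
    and l: "\<And>a. a \<in> K - {0} \<Longrightarrow> 0 < l \<bullet> a"
  shows "foldr (nuij w s) (replicate k l) f \<in> lorentzian_forms d K
    \<and> positive_near_interior d k (foldr (nuij w s) (replicate k l) f)"
proof (induction k)
  case 0
  then show ?case using f positive_near_interior_0[OF f d] by simp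
next
  case (Suc k)
  then show ?case
    using nuij_lorentzian[OF _ d less_imp_le[OF s] l] positive_near_interior_nuij[OF _ d s l] by simp
qed

lemma iterated_nuij_kernel:
  assumes f: "f \<in> lorentzian_forms d K" and p: "positive_near_interior d d f" and d: "2 \<le> d" and s: "0 < s"
    and L: "\<And>l a. l \<in> set L \<Longrightarrow> a \<in> K - {0} \<Longrightarrow> 0 < l \<bullet> a"
  shows "foldr (nuij w s) L f \<in> lorentzian_forms d K \<and> positive_near_interior d d (foldr (nuij w s) L f)
    \<and> (\<forall>as z. length as + 2 = d \<and> set as \<subseteq> K - {0} \<and> (\<forall>y. polar (foldr (nuij w s) L f) (y # z # as) = 0)
         \<longrightarrow> (\<forall>l\<in>set L. l \<bullet> z = 0))"
  using L
proof (induction L)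
  case (Cons l L)
  let ?g = "foldr (nuij w s) L f"
  have l: "\<And>a. a \<in> K - {0} \<Longrightarrow> 0 < l \<bullet> a" using Cons.prems by simp
  have g: "?g \<in> lorentzian_forms d K" "positive_near_interior d d ?g"
    and gk: "\<And>as z m. length as + 2 = d \<Longrightarrow> set as \<subseteq> K - {0} \<Longrightarrow> (\<And>y. polar ?g (y # z # as) = 0)
      \<Longrightarrow> m \<in> set L \<Longrightarrow> m \<bullet> z = 0"
    using Cons.IH[OF Cons.prems[OF list.set_intros(2)]] by blast+
  have gpos: "0 < polar ?g bs" if "length bs = d" "set bs \<subseteq> K - {0}" for bs
    using g(2) that by (simp add: positive_near_interior_full)
  have "nuij w s l ?g \<in> lorentzian_forms d K"
    by (rule nuij_lorentzian[OF g(1) d less_imp_le[OF s] l])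
  moreover have "positive_near_interior d d (nuij w s l ?g)"
    by (rule positive_near_interior_weaken[OF positive_near_interior_nuij[OF g(1) d s l g(2)]])
  moreover have "m \<bullet> z = 0" if as: "length as + 2 = d" "set as \<subseteq> K - {0}"
    and ker: "\<And>y. polar (nuij w s l ?g) (y # z # as) = 0" and m: "m \<in> set (l # L)" for as z m
    using nuij_kernel[OF g(1) d s l gpos as ker] gk[OF as] m by auto
  ultimately show ?case by auto
qed (use f p in auto)

lemma nonzero_lorentzian_in_closure:
  assumes f: "f \<in> lorentzian_forms d K" "f \<noteq> (\<lambda>_. 0)" and d: "2 \<le> d"
  shows "f \<in> closure (strictly_lorentzian_forms d K)"
proof -
  obtain L where L: "\<And>l a. l \<in> set L \<Longrightarrow> a \<in> K - {0} \<Longrightarrow> 0 < l \<bullet> a"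
      "\<And>z. (\<And>l. l \<in> set L \<Longrightarrow> l \<bullet> z = 0) \<Longrightarrow> z = 0" and ne: "L \<noteq> []"
    using separating_functionals[OF proper] by metis
  have hd: "0 < hd L \<bullet> a" if "a \<in> K - {0}" for a using L(1)[OF hd_in_set[OF ne] that] .
  \<comment> \<open>\<open>foldr\<close> starts at the right end, so the \<open>d\<close> steps that gain positivity come first\<close>
  define F where "F s = foldr (nuij w s) (L @ replicate d (hd L)) f" for s
  have strict: "F s \<in> strictly_lorentzian_forms d K" if s: "0 < s" for s
  proof -
    let ?g = "foldr (nuij w s) (replicate d (hd L)) f"
    have "?g \<in> lorentzian_forms d K" "positive_near_interior d d ?g"
      using iterated_nuij_positive[OF f d s hd, of d] by auto
    from iterated_nuij_kernel[OF this d s L(1), of L]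
    have F: "F s \<in> lorentzian_forms d K" "positive_near_interior d d (F s)"
      "\<And>as z l. length as + 2 = d \<Longrightarrow> set as \<subseteq> K - {0} \<Longrightarrow> (\<And>y. polar (F s) (y # z # as) = 0)
        \<Longrightarrow> l \<in> set L \<Longrightarrow> l \<bullet> z = 0"
      unfolding F_def foldr_append by blast+
    show ?thesis
      unfolding strictly_lorentzian_iff[OF d]
    proof (intro conjI allI impI)
      fix as z assume h: "length as + 2 = d \<and> set as \<subseteq> K - {0} \<and> (\<forall>y. polar (F s) (y # z # as) = 0)"
      show "z = 0" by (rule L(2), rule F(3)[of as]) (use h in auto)
    qed (use F(1) F(2)[unfolded positive_near_interior_full] in auto)
  qed
  have "continuous_on UNIV (\<lambda>s. foldr (nuij w s) M f \<alpha>)" for M \<alpha>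
    by (induction M arbitrary: \<alpha>) (auto intro!: continuous_nuij continuous_intros)
  then have "continuous_on UNIV F"
    unfolding F_def by (rule continuous_on_coordinatewise_then_product)
  then have "(F \<longlongrightarrow> F 0) (at_right 0)"
    by (metis UNIV_I continuous_on_def tendsto_within_subset subset_UNIV)
  moreover have "F 0 = f"
  proof -
    have "foldr (nuij w 0) M f = f" for M by (induction M) simp_all
    then show ?thesis by (simp only: F_def)
  qed
  moreover have "eventually (\<lambda>s. F s \<in> closure (strictly_lorentzian_forms d K)) (at_right 0)"
    using eventually_at_right_less[of "0::real"] strict closure_subset
    by (auto elim!: eventually_mono)
  ultimately show ?thesis
    using Lim_in_closed_set[OF closed_closure _ trivial_limit_at_right_real] by metis
qed

lemma zero_in_closure_strictly_lorentzian:
  assumes d: "2 \<le> d" shows "(\<lambda>_. 0) \<in> closure (strictly_lorentzian_forms d K)"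
proof -
  obtain L where L: "\<And>l a. l \<in> set L \<Longrightarrow> a \<in> K - {0} \<Longrightarrow> 0 < l \<bullet> a" and ne: "L \<noteq> []"
    using separating_functionals[OF proper] by metis
  have hd: "0 < hd L \<bullet> a" if "a \<in> K - {0}" for a using L(1)[OF hd_in_set[OF ne] that] .
  define F where "F s \<alpha> = s * divided_power (hd L) d \<alpha>" for s \<alpha>
  have "F s \<in> closure (strictly_lorentzian_forms d K)" if s: "0 < s" for s
  proof (rule nonzero_lorentzian_in_closure[OF _ _ d])
    show "F s \<in> lorentzian_forms d K"
      unfolding F_def using s by (intro lorentzian_scale[OF divided_power_lorentzian[OF d hd] d]) auto
    have "polar (F s) (replicate d w) = s * (hd L \<bullet> w) ^ d"
      unfolding F_def by (simp add: polar_scale polar_divided_power)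
    also have "\<dots> > 0" using s hd[OF w_cone(2)] by simp
    finally have "polar (F s) (replicate d w) \<noteq> 0" by simp
    then show "F s \<noteq> (\<lambda>_. 0)" by (metis polar_def dir_derivs_zero)
  qed
  then have "eventually (\<lambda>s. F s \<in> closure (strictly_lorentzian_forms d K)) (at_right 0)"
    using eventually_at_right_less[of "0::real"] by (auto elim!: eventually_mono)
  moreover have "continuous_on UNIV F"
    unfolding F_def by (intro continuous_on_coordinatewise_then_product continuous_intros)
  then have "(F \<longlongrightarrow> F 0) (at_right 0)"
    by (metis UNIV_I continuous_on_def tendsto_within_subset subset_UNIV)
  moreover have "F 0 = (\<lambda>_. 0)" by (simp add: F_def fun_eq_iff)
  ultimately show ?thesis
    using Lim_in_closed_set[OF closed_closure _ trivial_limit_at_right_real] by metis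
qed

end

theorem theorem4p9:
  fixes K :: "(real ^ 'n) set" and d :: nat
  assumes "proper_convex_cone K" and "d \<ge> 2"
  shows "strictly_lorentzian_forms d K = forms_topology d interior_of lorentzian_forms d K \<and>
    lorentzian_forms d K = forms_topology d closure_of strictly_lorentzian_forms d K"
proof
  obtain w where "w \<in> interior K" using assms(1) by (auto simp: proper_convex_cone_def)
  then interpret cone_with_interior_point K w using assms(1) by unfold_locales
  let ?S = "strictly_lorentzian_forms d K" and ?L = "lorentzian_forms d K"
  have sub: "?S \<subseteq> ?L" by (auto simp: strictly_lorentzian_forms_def)
  have Lf: "?L \<subseteq> forms d" using lorentzian_in_forms by blast
  obtain U where U: "open U" "?S = U \<inter> forms d" using strictly_lorentzian_open[OF assms(2)] by blast
  show "?S = forms_topology d interior_of ?L"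
  proof (rule subset_antisym)
    have "openin (forms_topology d) ?S" using U by (auto simp: openin_open)
    then show "?S \<subseteq> forms_topology d interior_of ?L" using sub by (rule interior_of_maximal[rotated])
    show "forms_topology d interior_of ?L \<subseteq> ?S"
    proof
      fix f assume "f \<in> forms_topology d interior_of ?L"
      then obtain T where T: "openin (forms_topology d) T" "f \<in> T" "T \<subseteq> ?L"
        by (auto simp: interior_of_def)
      then obtain V where "open V" "T = forms d \<inter> V" by (auto simp: openin_open)
      then show "f \<in> ?S"
        using T by (intro interior_point_strictly_lorentzian[OF assms(2), of V]) auto
    qed
  qed
  have "?L \<subseteq> closure ?S"
    using nonzero_lorentzian_in_closure[OF _ _ assms(2)] zero_in_closure_strictly_lorentzian[OF assms(2)]
    by blast
  moreover have "closure ?S \<subseteq> ?L"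
    by (rule closure_minimal[OF sub closed_lorentzian_forms[OF assms(2)]])
  ultimately have "closure ?S = ?L" by blast
  moreover have "forms d \<inter> ?S = ?S" using sub Lf by blast
  ultimately show "?L = forms_topology d closure_of ?S"
    using Lf by (auto simp: closure_of_subtopology)
qed

end
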